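(* Let $G$ be an ample groupoid, with singular ideal $J\trianglelefteq C^*_r(G)$ and algebraic singular ideal $J_{\mathbb{C}}=J\cap\mathbb{C}G$. Then $J_{\mathbb{C}}$ is dense in $J\cap\mathscr{C}_c(G)$ with respect to any $C^*$-norm on $\mathscr{C}_c(G)$.
   Context: An étale groupoid $G$ is a locally compact topological groupoid (possibly non-Hausdorff) whose unit space $G^{(0)}$ is Hausdorff and whose range and source maps $r,s\colon G\to G^{(0)}$ are local homeomorphisms. $G_x=s^{-1}(x)$. An open bisection is an open $U\subseteq G$ on which $r$ and $s$ restrict to homeomorphisms onto $r(U)$, $s(U)$. An ample groupoid is an étale groupoid with a basis of compact open bisections (no countability assumption is made). Its complex Steinberg algebra is $\mathbb{C}G:=\mathrm{span}\{\mathbbm{1}_U: U\subseteq G\text{ a compact open bisection}\}$. Connes' algebra $\mathscr{C}_c(G)\supseteq\mathbb{C}G$ is the linear span of functions $f\colon G\to\mathbb{C}$ for which there is an open bisection $U$ with $f|_U\in C_c(U)$, $f|_{G\setminus U}=0$; it is a $^*$-algebra with $(f_1*f_2)(g)=\sum_{h\in G_{s(g)}}f_1(gh^{-1})f_2(h)$ and $f^*(g)=\overline{f(g^{-1})}$. $C^*_r(G)$ is the completion of $\mathscr{C}_c(G)$ in the norm $\sup_x\|\lambda_x(f)\|$, where $\lambda_x(f)\xi=f*\xi$ on $\ell^2(G_x)$; its elements are viewed as functions on $G$ via $a(g)=\langle\lambda_{s(g)}(a)\delta_{s(g)},\delta_g\rangle$. The singular ideal is $J=\{a\in C^*_r(G):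 \{g: a(g)\neq0\}\text{ has empty interior}\}$. *)

theory Defs
  imports "HOL-Analysis.Analysis"
begin

section \<open>Topological, etale and ample groupoids\<close>

text \<open>
  The set of arrows is the underlying set of \<open>arr_top\<close>, and units are identified with their
  identity arrows, so that \<open>rng\<close> and \<open>src\<close> take values in arrows. The product \<open>mul G g h\<close> is
  meaningful only if \<open>src G g = rng G h\<close>.
\<close>

record 'g groupoid =
  arr_top :: "'g topology"
  rng :: "'g \<Rightarrow> 'g"
  src :: "'g \<Rightarrow> 'g"
  mul :: "'g \<Rightarrow> 'g \<Rightarrow> 'g"
  ginv :: "'g \<Rightarrow> 'g"

abbreviation arrows :: "'g groupoid \<Rightarrow> 'g set" where
  "arrows G \<equiv> topspace (arr_top G)"

definition units :: "'g groupoid \<Rightarrow> 'g set" where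
  "units G = rng G ` arrows G"

definition unit_top :: "'g groupoid \<Rightarrow> 'g topology" where
  "unit_top G = subtopology (arr_top G) (units G)"

definition composable :: "'g groupoid \<Rightarrow> ('g \<times> 'g) set" where
  "composable G = {(g, h). g \<in> arrows G \<and> h \<in> arrows G \<and> src G g = rng G h}"

definition src_fibre :: "'g groupoid \<Rightarrow> 'g \<Rightarrow> 'g set" where
  "src_fibre G x = {g \<in> arrows G. src G g = x}"

locale topological_groupoid =
  fixes G :: "'g groupoid"
  assumes rng_closed: "g \<in> arrows G \<Longrightarrow> rng G g \<in> arrows G"
    and src_in_units: "g \<in> arrows G \<Longrightarrow> src G g \<in> units G"
    and rng_unit: "x \<in> units G \<Longrightarrow> rng G x = x"
    and src_unit: "x \<in> units G \<Longrightarrow> src G x = x"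
    and mul_closed: "(g, h) \<in> composable G \<Longrightarrow> mul G g h \<in> arrows G"
    and rng_mul: "(g, h) \<in> composable G \<Longrightarrow> rng G (mul G g h) = rng G g"
    and src_mul: "(g, h) \<in> composable G \<Longrightarrow> src G (mul G g h) = src G h"
    and mul_assoc: "(g, h) \<in> composable G \<Longrightarrow> (h, k) \<in> composable G \<Longrightarrow>
      mul G (mul G g h) k = mul G g (mul G h k)"
    and mul_rng: "g \<in> arrows G \<Longrightarrow> mul G (rng G g) g = g"
    and mul_src: "g \<in> arrows G \<Longrightarrow> mul G g (src G g) = g"
    and inv_closed: "g \<in> arrows G \<Longrightarrow> ginv G g \<in> arrows G"
    and rng_inv: "g \<in> arrows G \<Longrightarrow> rng G (ginv G g) = src G g"
    and src_inv: "g \<in> arrows G \<Longrightarrow> src G (ginv G g) = rng G g"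
    and inv_mul: "g \<in> arrows G \<Longrightarrow> mul G (ginv G g) g = src G g"
    and mul_inv: "g \<in> arrows G \<Longrightarrow> mul G g (ginv G g) = rng G g"
    and continuous_rng: "continuous_map (arr_top G) (unit_top G) (rng G)"
    and continuous_src: "continuous_map (arr_top G) (unit_top G) (src G)"
    and continuous_mul: "continuous_map
      (subtopology (prod_topology (arr_top G) (arr_top G)) (composable G)) (arr_top G)
      (\<lambda>(g, h). mul G g h)"
    and continuous_inv: "continuous_map (arr_top G) (arr_top G) (ginv G)"

definition local_homeomorphism_map :: "'a topology \<Rightarrow> 'b topology \<Rightarrow> ('a \<Rightarrow> 'b) \<Rightarrow> bool" where
  "local_homeomorphism_map X Y f \<longleftrightarrow>
    (\<forall>x \<in> topspace X. \<exists>U. openin X U \<and> x \<in> U \<and> openin Y (f ` U) \<and>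
      homeomorphic_map (subtopology X U) (subtopology Y (f ` U)) f)"

locale etale_groupoid = topological_groupoid G for G :: "'g groupoid" +
  assumes locally_compact: "locally_compact_space (arr_top G)"
    and Hausdorff_units: "Hausdorff_space (unit_top G)"
    and rng_local_homeo: "local_homeomorphism_map (arr_top G) (unit_top G) (rng G)"
    and src_local_homeo: "local_homeomorphism_map (arr_top G) (unit_top G) (src G)"

definition open_bisection :: "'g groupoid \<Rightarrow> 'g set \<Rightarrow> bool" where
  "open_bisection G U \<longleftrightarrow> openin (arr_top G) U \<and>
    homeomorphic_map (subtopology (arr_top G) U) (subtopology (unit_top G) (rng G ` U)) (rng G) \<and>
    homeomorphic_map (subtopology (arr_top G) U) (subtopology (unit_top G) (src G ` U)) (src G)"

definition compact_open_bisection :: "'g groupoid \<Rightarrow> 'g set \<Rightarrow> bool" where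
  "compact_open_bisection G U \<longleftrightarrow> open_bisection G U \<and> compactin (arr_top G) U"

locale ample_groupoid = etale_groupoid G for G :: "'g groupoid" +
  assumes compact_open_bisection_base:
    "openin (arr_top G) W \<Longrightarrow> g \<in> W \<Longrightarrow> \<exists>U. compact_open_bisection G U \<and> g \<in> U \<and> U \<subseteq> W"


section \<open>The Steinberg algebra and Connes' algebra\<close>

text \<open>
  Functions on the groupoid are represented by functions on the whole type that vanish off
  the set of arrows.
\<close>

definition complex_span :: "('g \<Rightarrow> complex) set \<Rightarrow> ('g \<Rightarrow> complex) set" where
  "complex_span S = {(\<lambda>g. \<Sum>f\<in>F. c f * f g) | F c. finite F \<and> F \<subseteq> S}"

definition steinberg_algebra :: "'g groupoid \<Rightarrow> ('g \<Rightarrow> complex) set" where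
  "steinberg_algebra G = complex_span {indicator U | U. compact_open_bisection G U}"

definition Cc_on :: "'g topology \<Rightarrow> 'g set \<Rightarrow> ('g \<Rightarrow> complex) \<Rightarrow> bool" where
  "Cc_on X U f \<longleftrightarrow> continuous_map (subtopology X U) euclidean f \<and>
    compactin (subtopology X U) (subtopology X U closure_of {g \<in> U. f g \<noteq> 0})"

definition connes_algebra :: "'g groupoid \<Rightarrow> ('g \<Rightarrow> complex) set" where
  "connes_algebra G = complex_span
    {f. \<exists>U. open_bisection G U \<and> Cc_on (arr_top G) U f \<and> (\<forall>g. g \<notin> U \<longrightarrow> f g = 0)}"

text \<open>
  The sum is an unordered infinite sum; if the first argument lies in Connes' algebra, then only
  finitely many terms are nonzero. The second argument may also be a vector in some \<open>ell2 G x\<close>.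
\<close>

definition conv :: "'g groupoid \<Rightarrow> ('g \<Rightarrow> complex) \<Rightarrow> ('g \<Rightarrow> complex) \<Rightarrow> 'g \<Rightarrow> complex" where
  "conv G f1 f2 = (\<lambda>g. if g \<in> arrows G
     then \<Sum>\<^sub>\<infinity>h\<in>src_fibre G (src G g). f1 (mul G g (ginv G h)) * f2 h else 0)"

definition invol :: "'g groupoid \<Rightarrow> ('g \<Rightarrow> complex) \<Rightarrow> 'g \<Rightarrow> complex" where
  "invol G f = (\<lambda>g. if g \<in> arrows G then cnj (f (ginv G g)) else 0)"


section \<open>The reduced C*-algebra\<close>

definition ell2 :: "'g groupoid \<Rightarrow> 'g \<Rightarrow> ('g \<Rightarrow> complex) set" where
  "ell2 G x = {\<xi>. (\<forall>h. h \<notin> src_fibre G x \<longrightarrow> \<xi> h = 0) \<and>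
    (\<lambda>h. (cmod (\<xi> h))\<^sup>2) summable_on src_fibre G x}"

definition ell2_inner :: "'g groupoid \<Rightarrow> 'g \<Rightarrow> ('g \<Rightarrow> complex) \<Rightarrow> ('g \<Rightarrow> complex) \<Rightarrow> complex" where
  "ell2_inner G x \<xi> \<eta> = (\<Sum>\<^sub>\<infinity>h\<in>src_fibre G x. \<xi> h * cnj (\<eta> h))"

definition ell2_norm :: "'g groupoid \<Rightarrow> 'g \<Rightarrow> ('g \<Rightarrow> complex) \<Rightarrow> real" where
  "ell2_norm G x \<xi> = sqrt (\<Sum>\<^sub>\<infinity>h\<in>src_fibre G x. (cmod (\<xi> h))\<^sup>2)"

definition delta :: "'g \<Rightarrow> 'g \<Rightarrow> complex" where
  "delta g = indicator {g}"

definition bounded_ops :: "'g groupoid \<Rightarrow> 'g \<Rightarrow> (('g \<Rightarrow> complex) \<Rightarrow> ('g \<Rightarrow> complex)) set" where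
  "bounded_ops G x = {T \<in> ell2 G x \<rightarrow>\<^sub>E ell2 G x.
    (\<forall>\<xi>\<in>ell2 G x. \<forall>\<eta>\<in>ell2 G x. T (\<lambda>h. \<xi> h + \<eta> h) = (\<lambda>h. T \<xi> h + T \<eta> h)) \<and>
    (\<forall>c. \<forall>\<xi>\<in>ell2 G x. T (\<lambda>h. c * \<xi> h) = (\<lambda>h. c * T \<xi> h)) \<and>
    (\<exists>C. \<forall>\<xi>\<in>ell2 G x. ell2_norm G x (T \<xi>) \<le> C * ell2_norm G x \<xi>)}"

type_synonym 'g op_family = "'g \<Rightarrow> ('g \<Rightarrow> complex) \<Rightarrow> ('g \<Rightarrow> complex)"

definition regular_rep :: "'g groupoid \<Rightarrow> ('g \<Rightarrow> complex) \<Rightarrow> 'g op_family" where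
  "regular_rep G f = (\<lambda>x\<in>units G. \<lambda>\<xi>\<in>ell2 G x. conv G f \<xi>)"

definition reduced_norm :: "'g groupoid \<Rightarrow> 'g op_family \<Rightarrow> ennreal" where
  "reduced_norm G a = (SUP x\<in>units G. SUP \<xi>\<in>{\<xi>\<in>ell2 G x. ell2_norm G x \<xi> \<le> 1}.
     ennreal (ell2_norm G x (a x \<xi>)))"

text \<open>
  The map \<open>f \<mapsto> (\<lambda>\<^sub>x(f))\<^sub>x\<close> is isometric for the reduced norm, so the completion of Connes' algebra is
  realised as the closure of its image in the families of bounded operators on the spaces
  \<open>\<ell>\<^sup>2(G\<^sub>x)\<close>; the embedding of Connes' algebra into the completion is \<open>regular_rep G\<close>.
\<close>

definition reduced_Cstar :: "'g groupoid \<Rightarrow> 'g op_family set" where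
  "reduced_Cstar G = {a \<in> (\<Pi>\<^sub>E x\<in>units G. bounded_ops G x).
    \<forall>\<epsilon>>0. \<exists>f\<in>connes_algebra G.
      reduced_norm G (\<lambda>x \<xi> h. a x \<xi> h - regular_rep G f x \<xi> h) < ennreal \<epsilon>}"

definition coeff :: "'g groupoid \<Rightarrow> 'g op_family \<Rightarrow> 'g \<Rightarrow> complex" where
  "coeff G a g = ell2_inner G (src G g) (a (src G g) (delta (src G g))) (delta g)"

lemma delta_in_ell2: "h \<in> src_fibre G x \<Longrightarrow> delta h \<in> ell2 G x"
proof -
  assume h: "h \<in> src_fibre G x"
  have "(\<lambda>k. (cmod (delta h k))\<^sup>2) summable_on src_fibre G x
      \<longleftrightarrow> (\<lambda>k. (cmod (delta h k))\<^sup>2) summable_on {h}"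
    by (rule summable_on_cong_neutral) (use h in \<open>auto simp: delta_def\<close>)
  then show ?thesis using h by (auto simp: ell2_def delta_def indicator_def)
qed

text \<open>Viewing elements of the reduced algebra as functions is consistent with the embedding.\<close>

lemma (in topological_groupoid) coeff_regular_rep:
  assumes g: "g \<in> arrows G"
  shows "coeff G (regular_rep G f) g = f g"
proof -
  define x where "x = src G g"
  have x: "x \<in> units G" unfolding x_def using g by (rule src_in_units)
  have xa: "x \<in> arrows G" using x rng_closed by (auto simp: units_def)
  have sx: "src G x = x" and rx: "rng G x = x" using x src_unit rng_unit by auto
  have xf: "x \<in> src_fibre G x" and gf: "g \<in> src_fibre G x"
    using xa sx g by (auto simp: src_fibre_def x_def)
  have inv_x: "ginv G x = x"
    using mul_inv[OF xa] mul_rng[OF inv_closed[OF xa]] rng_inv[OF xa] sx rx by simp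
  have "conv G f (delta x) g = (\<Sum>\<^sub>\<infinity>h\<in>src_fibre G x. f (mul G g (ginv G h)) * delta x h)"
    using g by (simp add: conv_def x_def)
  also have "\<dots> = (\<Sum>\<^sub>\<infinity>h\<in>{x}. f (mul G g (ginv G h)) * delta x h)"
    by (rule infsum_cong_neutral) (use xf in \<open>auto simp: delta_def\<close>)
  also have "\<dots> = f g"
    using inv_x mul_src[OF g] by (simp add: delta_def x_def)
  finally have conv: "conv G f (delta x) g = f g" .
  have "coeff G (regular_rep G f) g
      = (\<Sum>\<^sub>\<infinity>h\<in>src_fibre G x. conv G f (delta x) h * cnj (delta g h))"
    using x delta_in_ell2[OF xf]
    by (simp add: coeff_def ell2_inner_def regular_rep_def flip: x_def)
  also have "\<dots> = (\<Sum>\<^sub>\<infinity>h\<in>{g}. conv G f (delta x) h * cnj (delta g h))"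
    by (rule infsum_cong_neutral) (use gf in \<open>auto simp: delta_def\<close>)
  also have "\<dots> = f g"
    using conv by (simp add: delta_def)
  finally show ?thesis .
qed

definition singular_ideal :: "'g groupoid \<Rightarrow> 'g op_family set" where
  "singular_ideal G = {a \<in> reduced_Cstar G.
    arr_top G interior_of {g \<in> arrows G. coeff G a g \<noteq> 0} = {}}"

definition singular_connes :: "'g groupoid \<Rightarrow> ('g \<Rightarrow> complex) set" where
  "singular_connes G = {f \<in> connes_algebra G. regular_rep G f \<in> singular_ideal G}"

definition algebraic_singular_ideal :: "'g groupoid \<Rightarrow> ('g \<Rightarrow> complex) set" where
  "algebraic_singular_ideal G = {f \<in> steinberg_algebra G. regular_rep G f \<in> singular_ideal G}"


section \<open>C*-norms and density\<close>

definition Cstar_norm_on_connes :: "'g groupoid \<Rightarrow> (('g \<Rightarrow> complex) \<Rightarrow> real) \<Rightarrow> bool" where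
  "Cstar_norm_on_connes G N \<longleftrightarrow>
    (\<forall>f\<in>connes_algebra G. 0 \<le> N f \<and> (N f = 0 \<longleftrightarrow> f = (\<lambda>g. 0))) \<and>
    (\<forall>c. \<forall>f\<in>connes_algebra G. N (\<lambda>g. c * f g) = cmod c * N f) \<and>
    (\<forall>f1\<in>connes_algebra G. \<forall>f2\<in>connes_algebra G. N (\<lambda>g. f1 g + f2 g) \<le> N f1 + N f2) \<and>
    (\<forall>f1\<in>connes_algebra G. \<forall>f2\<in>connes_algebra G. N (conv G f1 f2) \<le> N f1 * N f2) \<and>
    (\<forall>f\<in>connes_algebra G. N (conv G (invol G f) f) = (N f)\<^sup>2)"

definition dense_in_wrt ::
  "(('g \<Rightarrow> complex) \<Rightarrow> real) \<Rightarrow> ('g \<Rightarrow> complex) set \<Rightarrow> ('g \<Rightarrow> complex) set \<Rightarrow> bool" where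
  "dense_in_wrt N A B \<longleftrightarrow> A \<subseteq> B \<and> (\<forall>b\<in>B. \<forall>\<epsilon>>0. \<exists>a\<in>A. N (\<lambda>g. b g - a g) < \<epsilon>)"

end

theory Submission
  imports Defs
begin

text \<open>
  A function \<open>f\<close> in Connes' algebra is a finite sum of functions \<open>F\<^sub>i \<circ> s\<close> on compact open bisections
  \<open>U\<^sub>i\<close>, with \<open>F\<^sub>i\<close> continuous on the unit space. Let \<open>F\<^sub>S\<close> be the sum of the \<open>F\<^sub>i\<close> with \<open>i \<in> S\<close>. Every
  unit \<open>y\<close> has a compact open neighbourhood on which all \<open>F\<^sub>i\<close> are \<open>\<epsilon>\<close>-close to \<open>F\<^sub>i(y)\<close> and \<open>F\<^sub>S\<close> has no
  zero whenever \<open>F\<^sub>S(y) \<noteq> 0\<close>. Replacing each \<open>F\<^sub>i\<close> by \<open>F\<^sub>i(y)\<close> on a finite disjoint refinement of these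
  neighbourhoods gives \<open>a\<close> in the Steinberg algebra. If \<open>a\<close> had no zero on some nonempty open set,
  then on a smaller one the set \<open>S\<close> of those \<open>i\<close> with \<open>g \<in> U\<^sub>i\<close> would be constant, so that \<open>a = F\<^sub>S(y)\<close>
  and \<open>f = F\<^sub>S \<circ> s\<close> there; hence \<open>f\<close> would have no zero there either. So \<open>a\<close> is singular if \<open>f\<close> is.

  In any C*-norm, a function supported on a bisection is bounded by twice its supremum norm: its
  real and imaginary parts are multiples of means of unimodular functions \<open>w\<close> on the bisection, for
  which \<open>w\<^sup>* * w\<close> is the indicator of a set of units, a self-adjoint idempotent.
\<close>

section \<open>Linear spans of functions\<close>

lemma complex_span_zero: "(\<lambda>g. 0) \<in> complex_span S"
  unfolding complex_span_def by (rule CollectI, rule exI[of _ "{}"]) simp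

lemma complex_span_scale_base: "f \<in> S \<Longrightarrow> (\<lambda>g. c * f g) \<in> complex_span S"
  unfolding complex_span_def by (rule CollectI, rule exI[of _ "{f}"], rule exI[of _ "\<lambda>_. c"]) simp

lemma complex_span_base: "f \<in> S \<Longrightarrow> f \<in> complex_span S"
  using complex_span_scale_base[of f S 1] by simp

text \<open>A generator may occur in both sums, so both families of coefficients are first extended
  by zero to the union of the two finite sets.\<close>

lemma complex_span_add:
  assumes "f \<in> complex_span S" "h \<in> complex_span S"
  shows "(\<lambda>g. f g + h g) \<in> complex_span S"
proof -
  obtain F c where F: "finite F" "F \<subseteq> S" "f = (\<lambda>g. \<Sum>k\<in>F. c k * k g)"
    using assms(1) unfolding complex_span_def by auto
  obtain H d where H: "finite H" "H \<subseteq> S" "h = (\<lambda>g. \<Sum>k\<in>H. d k * k g)"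
    using assms(2) unfolding complex_span_def by auto
  define e where "e = (\<lambda>k. (if k \<in> F then c k else 0) + (if k \<in> H then d k else 0))"
  have "f g + h g = (\<Sum>k\<in>F \<union> H. e k * k g)" for g
  proof -
    have "f g = (\<Sum>k\<in>F \<union> H. (if k \<in> F then c k else 0) * k g)"
      unfolding F(3) by (rule sum.mono_neutral_cong_left) (use F H in auto)
    moreover have "h g = (\<Sum>k\<in>F \<union> H. (if k \<in> H then d k else 0) * k g)"
      unfolding H(3) by (rule sum.mono_neutral_cong_left) (use F H in auto)
    ultimately show ?thesis
      by (simp add: e_def distrib_right sum.distrib)
  qed
  then show ?thesis
    unfolding complex_span_def using F H
    by (intro CollectI exI[of _ "F \<union> H"] exI[of _ e]) auto
qed

lemma complex_span_scale:
  assumes "f \<in> complex_span S"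
  shows "(\<lambda>g. c * f g) \<in> complex_span S"
proof -
  obtain F d where F: "finite F" "F \<subseteq> S" "f = (\<lambda>g. \<Sum>k\<in>F. d k * k g)"
    using assms unfolding complex_span_def by auto
  then show ?thesis
    unfolding complex_span_def
    by (intro CollectI exI[of _ F] exI[of _ "\<lambda>k. c * d k"])
      (auto simp: sum_distrib_left mult.assoc)
qed

lemma complex_span_sum:
  assumes "finite I" "\<And>i. i \<in> I \<Longrightarrow> h i \<in> complex_span S"
  shows "(\<lambda>g. \<Sum>i\<in>I. h i g) \<in> complex_span S"
  using assms by (induction I rule: finite_induct) (auto simp: complex_span_zero complex_span_add)

text \<open>The step is asymmetric: it only ever adds a multiple of a generator, which suits
  estimates known for single bisections.\<close>

lemma complex_span_induct [consumes 1, case_names zero step]: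
  assumes f: "f \<in> complex_span S"
    and zero: "P (\<lambda>g. 0)"
    and step: "\<And>c k h. k \<in> S \<Longrightarrow> P h \<Longrightarrow> P (\<lambda>g. c * k g + h g)"
  shows "P f"
proof -
  obtain F c where F: "finite F" "F \<subseteq> S" "f = (\<lambda>g. \<Sum>k\<in>F. c k * k g)"
    using f unfolding complex_span_def by auto
  have "P (\<lambda>g. \<Sum>k\<in>F. c k * k g)"
    using F(1,2) by (induction F rule: finite_induct) (auto simp: zero step)
  then show ?thesis using F(3) by simp
qed


section \<open>Topological preliminaries\<close>

text \<open>A clopen set has empty frontier, so the compatibility condition for gluing with the zero
  function is vacuous.\<close>

lemma continuous_map_indicator_clopen:
  assumes "openin X A" "closedin X A" "continuous_map (subtopology X A) euclidean f"
  shows "continuous_map X euclidean (\<lambda>x. if x \<in> A then f x else (0 :: 'b :: real_normed_vector))"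
proof (rule continuous_map_cases)
  show "continuous_map (subtopology X (X closure_of {x. x \<in> A})) euclidean f"
    using assms closure_of_closedin by fastforce
  show "continuous_map (subtopology X (X closure_of {x. x \<notin> A})) euclidean (\<lambda>x. 0)"
    by simp
  show "f x = 0" if "x \<in> X frontier_of {x. x \<in> A}" for x
    using that assms by (simp add: frontier_of_def closure_of_closedin interior_of_openin)
qed

text \<open>Each new set is reduced by the union of the earlier ones; finite unions of clopen sets
  are clopen, so the difference is again clopen.\<close>

lemma disjoint_clopen_refinement:
  assumes "finite Y" "\<And>y. y \<in> Y \<Longrightarrow> openin X (W y) \<and> closedin X (W y)"
  shows "\<exists>V. (\<forall>y\<in>Y. openin X (V y) \<and> closedin X (V y) \<and> V y \<subseteq> W y) \<and>
    disjoint_family_on V Y \<and> (\<Union>y\<in>Y. V y) = (\<Union>y\<in>Y. W y)"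
  using assms
proof (induction Y rule: finite_induct)
  case empty
  then show ?case by (auto simp: disjoint_family_on_def)
next
  case (insert y Y)
  then obtain V where V: "\<And>z. z \<in> Y \<Longrightarrow> openin X (V z) \<and> closedin X (V z) \<and> V z \<subseteq> W z"
    "disjoint_family_on V Y" "(\<Union>y\<in>Y. V y) = (\<Union>y\<in>Y. W y)"
    by auto
  define V' where "V' = V(y := W y - (\<Union>z\<in>Y. W z))"
  have "openin X (\<Union>z\<in>Y. W z)" "closedin X (\<Union>z\<in>Y. W z)"
    using insert by (auto intro!: closedin_Union openin_Union)
  then have y: "openin X (V' y) \<and> closedin X (V' y) \<and> V' y \<subseteq> W y"
    using insert by (auto simp: V'_def openin_diff closedin_diff)
  have "\<forall>z\<in>insert y Y. openin X (V' z) \<and> closedin X (V' z) \<and> V' z \<subseteq> W z"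
    using y V(1) insert.hyps by (auto simp: V'_def)
  moreover have "disjoint_family_on V' (insert y Y)"
  proof -
    have "V' y \<inter> (\<Union>z\<in>Y. V' z) = {}"
      using V(3) insert.hyps by (auto simp: V'_def)
    moreover have "disjoint_family_on V' Y"
      using V(2) insert.hyps by (auto simp: disjoint_family_on_def V'_def)
    ultimately show ?thesis using insert.hyps by (simp add: disjoint_family_on_insert)
  qed
  moreover have "(\<Union>z\<in>insert y Y. V' z) = (\<Union>z\<in>insert y Y. W z)"
    using V(3) insert.hyps by (auto simp: V'_def)
  ultimately show ?case by blast
qed

text \<open>The set of indices only grows near a point, hence it is locally constant at a point of
  \<open>W\<close> where its cardinality is maximal.\<close>

lemma open_constant_membership:
  assumes I: "finite I" and U: "\<And>i. i \<in> I \<Longrightarrow> openin X (U i)"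
    and W: "openin X W" "W \<noteq> {}"
  obtains W' S where "openin X W'" "W' \<noteq> {}" "W' \<subseteq> W" "S \<subseteq> I"
    "\<And>g. g \<in> W' \<Longrightarrow> {i \<in> I. g \<in> U i} = S"
proof -
  let ?S = "\<lambda>g. {i \<in> I. g \<in> U i}"
  have fin: "finite ((\<lambda>g. card (?S g)) ` W)"
    by (rule finite_subset[of _ "{..card I}"]) (auto intro!: card_mono I)
  obtain g where g: "g \<in> W" "card (?S g) = Max ((\<lambda>g. card (?S g)) ` W)"
    using Max_in[OF fin] W by (metis (no_types, lifting) imageE image_is_empty)
  define W' where "W' = W \<inter> (topspace X \<inter> (\<Inter>i\<in>?S g. U i))"
  have "openin X W'"
    unfolding W'_def using W(1) U I by (intro openin_Int openin_Int_Inter) auto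
  moreover have "g \<in> W'"
    using g W(1) openin_subset unfolding W'_def by fastforce
  moreover have "?S h = ?S g" if "h \<in> W'" for h
  proof (rule card_seteq[symmetric])
    show "finite (?S h)" using I by simp
    show "?S g \<subseteq> ?S h" using that by (auto simp: W'_def)
    have "h \<in> W" using that by (auto simp: W'_def)
    then show "card (?S h) \<le> card (?S g)" using g(2) fin by simp
  qed
  moreover have "W' \<subseteq> W" "?S g \<subseteq> I" by (auto simp: W'_def)
  ultimately show ?thesis by (intro that[of W' "?S g"]) blast+
qed

text \<open>Openness is checked pointwise: the image of \<open>U \<inter> V\<close> is open in the
  image of the chart \<open>V\<close>, which is itself open in \<open>Y\<close>.\<close>

lemma local_homeomorphism_open_map:
  assumes "local_homeomorphism_map X Y f"
  shows "open_map X Y f"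
  unfolding open_map_def
proof (intro allI impI)
  fix U assume U: "openin X U"
  show "openin Y (f ` U)"
  proof (subst openin_subopen, intro ballI)
    fix y assume "y \<in> f ` U"
    then obtain x where x: "x \<in> U" "y = f x" by auto
    then have "x \<in> topspace X" using U openin_subset by blast
    then obtain V where V: "openin X V" "x \<in> V" "openin Y (f ` V)"
      "homeomorphic_map (subtopology X V) (subtopology Y (f ` V)) f"
      using assms unfolding local_homeomorphism_map_def by blast
    have "openin (subtopology X V) (U \<inter> V)"
      using U by (auto simp: openin_subtopology)
    then have "openin (subtopology Y (f ` V)) (f ` (U \<inter> V))"
      using homeomorphic_imp_open_map[OF V(4)] by (simp add: open_map_def)
    then have "openin Y (f ` (U \<inter> V))"
      using V(3) openin_trans_full by blast
    then show "\<exists>T. openin Y T \<and> y \<in> T \<and> T \<subseteq> f ` U"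
      using x V(2) by (intro exI[of _ "f ` (U \<inter> V)"]) auto
  qed
qed


text \<open>Used to shrink open bisections.\<close>

lemma homeomorphic_map_image_restrict:
  assumes f: "homeomorphic_map (subtopology X U) (subtopology Y (f ` U)) f"
    and V: "V \<subseteq> U" "U \<subseteq> topspace X"
  shows "homeomorphic_map (subtopology X V) (subtopology Y (f ` V)) f"
proof -
  have U: "topspace X \<inter> U = U" and UV: "U \<inter> V = V" "f ` U \<inter> f ` V = f ` V"
    using V by auto
  have "topspace Y \<inter> f ` U = f ` U"
    using homeomorphic_imp_surjective_map[OF f] by (simp only: topspace_subtopology U)
  then have "f ` (topspace (subtopology X U) \<inter> V) = topspace (subtopology Y (f ` U)) \<inter> f ` V"
    by (simp only: topspace_subtopology U UV)
  then have "homeomorphic_map (subtopology (subtopology X U) V)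
     (subtopology (subtopology Y (f ` U)) (f ` V)) f"
    by (rule homeomorphic_map_subtopologies[OF f])
  then show ?thesis by (simp only: subtopology_subtopology UV)
qed


section \<open>Bisections\<close>

context topological_groupoid
begin

lemma units_subset: "units G \<subseteq> arrows G"
  using rng_closed by (auto simp: units_def)

lemma topspace_unit_top: "topspace (unit_top G) = units G"
  using units_subset by (auto simp: unit_top_def)

lemma src_closed: "g \<in> arrows G \<Longrightarrow> src G g \<in> arrows G"
  using src_in_units units_subset by blast

lemma composable_inv:
  "g \<in> arrows G \<Longrightarrow> h \<in> arrows G \<Longrightarrow> src G g = src G h \<Longrightarrow> (g, ginv G h) \<in> composable G"
  by (auto simp: composable_def inv_closed rng_inv)

lemma mul_ginv_closed:
  assumes "g \<in> arrows G" "h \<in> arrows G" "src G g = src G h"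
  shows "mul G g (ginv G h) \<in> arrows G" "rng G (mul G g (ginv G h)) = rng G g"
    "src G (mul G g (ginv G h)) = rng G h"
  using composable_inv[OF assms] assms by (simp_all add: mul_closed rng_mul src_mul src_inv)

lemma mul_ginv_cancel:
  assumes "g \<in> arrows G" "h \<in> arrows G" "src G g = src G h"
  shows "mul G (mul G g (ginv G h)) h = g"
proof -
  have "(ginv G h, h) \<in> composable G"
    using assms by (simp add: composable_def inv_closed src_inv)
  then have "mul G (mul G g (ginv G h)) h = mul G g (mul G (ginv G h) h)"
    using mul_assoc composable_inv assms by blast
  then show ?thesis using assms inv_mul mul_src by metis
qed

text \<open>Follows by bracketing the product of the double inverse, the inverse and
  \<open>h\<close> in two ways.\<close>

lemma ginv_ginv:
  assumes h: "h \<in> arrows G"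
  shows "ginv G (ginv G h) = h"
proof -
  have i: "ginv G h \<in> arrows G" and ii: "ginv G (ginv G h) \<in> arrows G"
    using h by (simp_all add: inv_closed)
  have "ginv G (ginv G h) = mul G (ginv G (ginv G h)) (mul G (ginv G h) h)"
    using mul_src[OF ii] inv_mul[OF h] src_inv[OF i] rng_inv[OF h] by simp
  also have "\<dots> = mul G (mul G (ginv G (ginv G h)) (ginv G h)) h"
    using mul_assoc[of "ginv G (ginv G h)" "ginv G h" h] h i ii
    by (simp add: composable_def src_inv rng_inv)
  also have "\<dots> = h"
    using inv_mul[OF i] src_inv[OF h] mul_rng[OF h] by simp
  finally show ?thesis .
qed

text \<open>Both arrows are recovered as the inverse of the common product times \<open>g\<close>.
  With injectivity of \<open>rng\<close> on a bisection this leaves at most one non-zero entry in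
  each row of its convolution matrix.\<close>

lemma mul_ginv_inj_right:
  assumes "g \<in> arrows G" "h \<in> arrows G" "k \<in> arrows G" "src G g = src G h" "src G g = src G k"
    and eq: "mul G g (ginv G h) = mul G g (ginv G k)"
  shows "h = k"
proof -
  define p where "p = mul G g (ginv G h)"
  have p: "p \<in> arrows G" "src G p = rng G h" "src G p = rng G k"
    using mul_ginv_closed assms p_def by metis+
  have c: "mul G p h = g" "mul G p k = g"
    using mul_ginv_cancel assms p_def by metis+
  have *: "mul G (ginv G p) (mul G p l) = l" if l: "l \<in> arrows G" "src G p = rng G l" for l
  proof -
    have "mul G (ginv G p) (mul G p l) = mul G (mul G (ginv G p) p) l"
      using mul_assoc[of "ginv G p" p l] p l by (simp add: composable_def src_inv inv_closed)
    then show ?thesis using p(1) l by (simp add: inv_mul mul_rng)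
  qed
  show ?thesis using *[of h] *[of k] p c assms by metis
qed

section \<open>Open bisections and the generators of the two function algebras\<close>

lemma open_bisection_open: "open_bisection G U \<Longrightarrow> openin (arr_top G) U"
  by (simp add: open_bisection_def)

lemma open_bisection_subset: "open_bisection G U \<Longrightarrow> U \<subseteq> arrows G"
  using open_bisection_open openin_subset by blast

lemma open_bisection_inj:
  assumes "open_bisection G U"
  shows "inj_on (rng G) U" "inj_on (src G) U"
proof -
  have "topspace (subtopology (arr_top G) U) = U"
    using open_bisection_subset[OF assms] by auto
  then show "inj_on (rng G) U" "inj_on (src G) U"
    using assms homeomorphic_imp_injective_map unfolding open_bisection_def by metis+
qed

lemma open_bisection_open_subset:
  assumes U: "open_bisection G U" and V: "openin (arr_top G) V" "V \<subseteq> U"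
  shows "open_bisection G V"
  using assms homeomorphic_map_image_restrict[OF _ V(2) open_bisection_subset[OF U]]
  unfolding open_bisection_def by blast

lemma indicator_in_steinberg: "compact_open_bisection G U \<Longrightarrow> indicator U \<in> steinberg_algebra G"
  unfolding steinberg_algebra_def by (rule complex_span_base) auto

text \<open>Compactness of \<open>U\<close> takes care of the support: a closed subset of the
  compact space \<open>U\<close> is compact.\<close>

lemma connes_algebraI:
  assumes U: "compact_open_bisection G U"
    and f: "continuous_map (subtopology (arr_top G) U) euclidean f" "\<And>g. g \<notin> U \<Longrightarrow> f g = 0"
  shows "f \<in> connes_algebra G"
proof -
  have U': "open_bisection G U" "compactin (arr_top G) U"
    using U by (auto simp: compact_open_bisection_def)
  have "compactin (subtopology (arr_top G) U) U"
    using U' by (simp add: compactin_subtopology)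
  moreover have "subtopology (arr_top G) U closure_of {g \<in> U. f g \<noteq> 0} \<subseteq> U"
    using closure_of_subset_topspace by fastforce
  ultimately have "Cc_on (arr_top G) U f"
    unfolding Cc_on_def using f(1) closed_compactin closedin_closure_of by blast
  then show ?thesis
    unfolding connes_algebra_def using U'(1) f(2) by (intro complex_span_base) blast
qed

lemma steinberg_subset_connes: "steinberg_algebra G \<subseteq> connes_algebra G"
proof
  fix f assume f: "f \<in> steinberg_algebra G"
  have "indicator U \<in> connes_algebra G" if U: "compact_open_bisection G U" for U
  proof (rule connes_algebraI[OF U])
    have "continuous_map (subtopology (arr_top G) U) euclidean (\<lambda>g. 1 :: complex)" by simp
    then show "continuous_map (subtopology (arr_top G) U) euclidean (indicator U :: _ \<Rightarrow> complex)"
      by (rule continuous_map_eq) auto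
  qed auto
  note * = this
  show "f \<in> connes_algebra G"
    using f unfolding steinberg_algebra_def
  proof (induction rule: complex_span_induct)
    case zero
    show ?case by (simp add: connes_algebra_def complex_span_zero)
  next
    case (step c k h)
    then show ?case
      using * unfolding connes_algebra_def by (auto intro!: complex_span_add complex_span_scale)
  qed
qed

end


section \<open>The regular representation of the Steinberg algebra\<close>

lemma norm_add_sq_le: "(norm (a + b))\<^sup>2 \<le> 2 * (norm a)\<^sup>2 + 2 * (norm b)\<^sup>2"
  for a b :: "'a :: real_normed_vector"
proof -
  have "(norm (a + b))\<^sup>2 \<le> (norm a + norm b)\<^sup>2"
    by (intro power_mono norm_triangle_ineq) simp
  also have "\<dots> \<le> 2 * (norm a)\<^sup>2 + 2 * (norm b)\<^sup>2"
    using sum_squares_bound[of "norm a" "norm b"] by (simp add: power2_sum)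
  finally show ?thesis .
qed

text \<open>The factor 2 replaces the sharp triangle inequality; later only the existence of some
  operator bound matters.\<close>

lemma summable_add_sq:
  fixes u v :: "'a \<Rightarrow> complex"
  assumes u: "(\<lambda>g. (cmod (u g))\<^sup>2) summable_on A" and v: "(\<lambda>g. (cmod (v g))\<^sup>2) summable_on A"
  shows "(\<lambda>g. (cmod (c * u g + v g))\<^sup>2) summable_on A"
    and "(\<Sum>\<^sub>\<infinity>g\<in>A. (cmod (c * u g + v g))\<^sup>2) \<le>
      2 * (cmod c)\<^sup>2 * (\<Sum>\<^sub>\<infinity>g\<in>A. (cmod (u g))\<^sup>2) + 2 * (\<Sum>\<^sub>\<infinity>g\<in>A. (cmod (v g))\<^sup>2)"
proof -
  let ?w = "\<lambda>g. 2 * (cmod c)\<^sup>2 * (cmod (u g))\<^sup>2 + 2 * (cmod (v g))\<^sup>2"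
  have le: "(cmod (c * u g + v g))\<^sup>2 \<le> ?w g" for g
    using norm_add_sq_le[of "c * u g" "v g"] by (simp add: norm_mult power_mult_distrib mult.assoc)
  have su: "(\<lambda>g. 2 * (cmod c)\<^sup>2 * (cmod (u g))\<^sup>2) summable_on A"
    using u by (rule summable_on_cmult_right)
  have sv: "(\<lambda>g. 2 * (cmod (v g))\<^sup>2) summable_on A"
    using v by (rule summable_on_cmult_right)
  have w: "?w summable_on A" using su sv by (rule summable_on_add)
  show s: "(\<lambda>g. (cmod (c * u g + v g))\<^sup>2) summable_on A"
    by (rule summable_on_comparison_test[OF w]) (use le in auto)
  have "(\<Sum>\<^sub>\<infinity>g\<in>A. (cmod (c * u g + v g))\<^sup>2) \<le> infsum ?w A"
    by (rule infsum_mono[OF s w le])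
  also have "\<dots> = 2 * (cmod c)\<^sup>2 * (\<Sum>\<^sub>\<infinity>g\<in>A. (cmod (u g))\<^sup>2) + 2 * (\<Sum>\<^sub>\<infinity>g\<in>A. (cmod (v g))\<^sup>2)"
    unfolding infsum_add[OF su sv] by (simp add: infsum_cmult_right')
  finally show "(\<Sum>\<^sub>\<infinity>g\<in>A. (cmod (c * u g + v g))\<^sup>2) \<le>
      2 * (cmod c)\<^sup>2 * (\<Sum>\<^sub>\<infinity>g\<in>A. (cmod (u g))\<^sup>2) + 2 * (\<Sum>\<^sub>\<infinity>g\<in>A. (cmod (v g))\<^sup>2)" .
qed

text \<open>Additivity of \<open>infsum\<close> requires summability, since a non-summable family
  has the default sum 0. Finite rows provide it for every vector.\<close>

lemma summable_on_finite_support: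
  assumes "finite {h \<in> A. f h \<noteq> 0}"
  shows "(\<lambda>h. f h * (\<xi> h :: complex)) summable_on A"
proof -
  have "(\<lambda>h. f h * \<xi> h) summable_on A \<longleftrightarrow> (\<lambda>h. f h * \<xi> h) summable_on {h \<in> A. f h \<noteq> 0}"
    by (rule summable_on_cong_neutral) auto
  then show ?thesis using assms by simp
qed

lemma ell2_add_scale:
  assumes "\<xi> \<in> ell2 G x" "\<eta> \<in> ell2 G x"
  shows "(\<lambda>h. c * \<xi> h + \<eta> h) \<in> ell2 G x"
  using assms summable_add_sq(1)[of \<xi> "src_fibre G x" \<eta> c] unfolding ell2_def by auto

lemma ell2_zero: "(\<lambda>h. 0) \<in> ell2 G x"
  by (simp add: ell2_def)

section \<open>Convolution as an operator on one source fibre\<close>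

lemma conv_src_fibre:
  "g \<in> src_fibre G x \<Longrightarrow> conv G f \<xi> g = (\<Sum>\<^sub>\<infinity>h\<in>src_fibre G x. f (mul G g (ginv G h)) * \<xi> h)"
  by (auto simp: conv_def src_fibre_def)

lemma conv_outside_src_fibre:
  assumes "\<xi> \<in> ell2 G x" "g \<notin> src_fibre G x"
  shows "conv G f \<xi> g = 0"
proof (cases "g \<in> arrows G")
  case True
  then have "\<xi> h = 0" if "h \<in> src_fibre G (src G g)" for h
    using that assms by (auto simp: ell2_def src_fibre_def)
  then show ?thesis by (simp add: conv_def infsum_0)
qed (simp add: conv_def)

text \<open>In the basis of point masses, convolution by \<open>f\<close> over \<open>x\<close> is
  the matrix with entry \<open>f (mul G g (ginv G h))\<close> in row \<open>g\<close> and column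
  \<open>h\<close>.\<close>

definition finite_rows :: "'g groupoid \<Rightarrow> 'g \<Rightarrow> ('g \<Rightarrow> complex) \<Rightarrow> bool" where
  "finite_rows G x f \<longleftrightarrow>
    (\<forall>g\<in>src_fibre G x. finite {h \<in> src_fibre G x. f (mul G g (ginv G h)) \<noteq> 0})"

text \<open>The constant bounds the square of the operator norm, which avoids square roots when
  bounds are combined.\<close>

definition ell2_bounded :: "'g groupoid \<Rightarrow> 'g \<Rightarrow> ('g \<Rightarrow> complex) \<Rightarrow> real \<Rightarrow> bool" where
  "ell2_bounded G x f C \<longleftrightarrow> (\<forall>\<xi>\<in>ell2 G x.
    (\<lambda>g. (cmod (conv G f \<xi> g))\<^sup>2) summable_on src_fibre G x \<and>
    (\<Sum>\<^sub>\<infinity>g\<in>src_fibre G x. (cmod (conv G f \<xi> g))\<^sup>2) \<le> C * (\<Sum>\<^sub>\<infinity>g\<in>src_fibre G x. (cmod (\<xi> g))\<^sup>2))"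

lemma conv_scale_add_left:
  assumes "finite_rows G x k" "finite_rows G x f" "g \<in> src_fibre G x"
  shows "conv G (\<lambda>g. c * k g + f g) \<xi> g = c * conv G k \<xi> g + conv G f \<xi> g"
proof -
  have k: "(\<lambda>h. k (mul G g (ginv G h)) * \<xi> h) summable_on src_fibre G x"
    using assms unfolding finite_rows_def by (intro summable_on_finite_support) auto
  have f: "(\<lambda>h. f (mul G g (ginv G h)) * \<xi> h) summable_on src_fibre G x"
    using assms unfolding finite_rows_def by (intro summable_on_finite_support) auto
  have "conv G (\<lambda>g. c * k g + f g) \<xi> g = (\<Sum>\<^sub>\<infinity>h\<in>src_fibre G x.
      c * (k (mul G g (ginv G h)) * \<xi> h) + f (mul G g (ginv G h)) * \<xi> h)"
    using assms(3) by (simp add: conv_src_fibre algebra_simps)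
  also have "\<dots> = c * conv G k \<xi> g + conv G f \<xi> g"
    using assms(3) infsum_add[OF summable_on_cmult_right[OF k, of c] f]
    by (simp add: conv_src_fibre infsum_cmult_right')
  finally show ?thesis .
qed

lemma conv_scale_add_right:
  assumes "finite_rows G x f" "\<xi> \<in> ell2 G x" "\<eta> \<in> ell2 G x"
  shows "conv G f (\<lambda>h. c * \<xi> h + \<eta> h) = (\<lambda>g. c * conv G f \<xi> g + conv G f \<eta> g)"
proof
  fix g
  show "conv G f (\<lambda>h. c * \<xi> h + \<eta> h) g = c * conv G f \<xi> g + conv G f \<eta> g"
  proof (cases "g \<in> src_fibre G x")
    case True
    have s: "(\<lambda>h. f (mul G g (ginv G h)) * \<zeta> h) summable_on src_fibre G x" for \<zeta> :: "'a \<Rightarrow> complex"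
      using assms True unfolding finite_rows_def by (intro summable_on_finite_support) auto
    have "conv G f (\<lambda>h. c * \<xi> h + \<eta> h) g = (\<Sum>\<^sub>\<infinity>h\<in>src_fibre G x.
        c * (f (mul G g (ginv G h)) * \<xi> h) + f (mul G g (ginv G h)) * \<eta> h)"
      using True by (simp add: conv_src_fibre algebra_simps)
    also have "\<dots> = c * conv G f \<xi> g + conv G f \<eta> g"
      using True infsum_add[OF summable_on_cmult_right[OF s, of c] s]
      by (simp add: conv_src_fibre infsum_cmult_right')
    finally show ?thesis .
  next
    case False
    then show ?thesis
      using conv_outside_src_fibre[OF assms(2) False] conv_outside_src_fibre[OF assms(3) False]
        conv_outside_src_fibre[OF ell2_add_scale[OF assms(2,3)] False] by simp
  qed
qed

lemma conv_bounded_op: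
  assumes f: "finite_rows G x f" and C: "ell2_bounded G x f C"
  shows "(\<lambda>\<xi>\<in>ell2 G x. conv G f \<xi>) \<in> bounded_ops G x"
proof -
  have mem: "conv G f \<xi> \<in> ell2 G x" if "\<xi> \<in> ell2 G x" for \<xi>
    using that C conv_outside_src_fibre[OF that] unfolding ell2_bounded_def
    by (subst ell2_def) auto
  have add: "conv G f (\<lambda>h. \<xi> h + \<eta> h) = (\<lambda>h. conv G f \<xi> h + conv G f \<eta> h)"
      "(\<lambda>h. \<xi> h + \<eta> h) \<in> ell2 G x" if "\<xi> \<in> ell2 G x" "\<eta> \<in> ell2 G x" for \<xi> \<eta>
    using conv_scale_add_right[OF f that, of 1] ell2_add_scale[OF that, of 1] by simp_all
  have "conv G f (\<lambda>h. 0) = (\<lambda>h. 0)" by (auto simp: conv_def)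
  then have scale: "conv G f (\<lambda>h. c * \<xi> h) = (\<lambda>h. c * conv G f \<xi> h)"
      "(\<lambda>h. c * \<xi> h) \<in> ell2 G x" if "\<xi> \<in> ell2 G x" for \<xi> c
    using conv_scale_add_right[OF f that ell2_zero, of c] ell2_add_scale[OF that ell2_zero, of c]
    by simp_all
  have "ell2_norm G x (conv G f \<xi>) \<le> sqrt C * ell2_norm G x \<xi>" if "\<xi> \<in> ell2 G x" for \<xi>
    using that C unfolding ell2_bounded_def ell2_norm_def
    by (metis real_sqrt_le_mono real_sqrt_mult)
  then have bound: "\<exists>C. \<forall>\<xi>\<in>ell2 G x. ell2_norm G x (conv G f \<xi>) \<le> C * ell2_norm G x \<xi>"
    by blast
  show ?thesis
    unfolding bounded_ops_def by (simp add: mem add scale bound)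
qed

context topological_groupoid
begin

text \<open>The matrix is a partial permutation matrix: injectivity of \<open>rng\<close> gives at
  most one 1 in each row, injectivity of \<open>src\<close> at most one in each column. So it merely
  rearranges some coordinates of a vector and drops the others.\<close>

lemma bisection_ell2_bounded:
  assumes U: "open_bisection G U"
  shows "finite_rows G x (indicator U)" "ell2_bounded G x (indicator U) 1"
proof -
  let ?F = "src_fibre G x"
  have F: "h \<in> arrows G" "src G h = x" if "h \<in> ?F" for h
    using that by (auto simp: src_fibre_def)
  \<comment> \<open>All products in row \<open>g\<close> have the range of \<open>g\<close>.\<close>
  have right: "h = k" if "g \<in> ?F" "h \<in> ?F" "k \<in> ?F"
    "mul G g (ginv G h) \<in> U" "mul G g (ginv G k) \<in> U" for g h k
  proof (rule mul_ginv_inj_right)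
    show "mul G g (ginv G h) = mul G g (ginv G k)"
      using inj_onD[OF open_bisection_inj(1)[OF U] _ that(4,5)] mul_ginv_closed(2) F that by metis
  qed (use F that in auto)
  \<comment> \<open>All products in column \<open>h\<close> have source
    \<open>rng G h\<close>.\<close>
  have left: "g = k" if "g \<in> ?F" "h \<in> ?F" "k \<in> ?F"
    "mul G g (ginv G h) \<in> U" "mul G k (ginv G h) \<in> U" for g h k
  proof -
    have "mul G g (ginv G h) = mul G k (ginv G h)"
      using inj_onD[OF open_bisection_inj(2)[OF U] _ that(4,5)] mul_ginv_closed(3) F that by metis
    then show ?thesis using mul_ginv_cancel F that by metis
  qed
  show "finite_rows G x (indicator U)"
    unfolding finite_rows_def
  proof
    fix g assume g: "g \<in> ?F"
    show "finite {h \<in> ?F. (indicator U (mul G g (ginv G h)) :: complex) \<noteq> 0}"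
    proof (cases "\<exists>h\<in>?F. mul G g (ginv G h) \<in> U")
      case True
      then obtain h where "h \<in> ?F" "mul G g (ginv G h) \<in> U" by blast
      then have "{h \<in> ?F. (indicator U (mul G g (ginv G h)) :: complex) \<noteq> 0} \<subseteq> {h}"
        using right g by (auto simp: indicator_def split: if_splits)
      then show ?thesis by (rule finite_subset) simp
    next
      case False
      then have "{h \<in> ?F. (indicator U (mul G g (ginv G h)) :: complex) \<noteq> 0} = {}"
        by (auto simp: indicator_def)
      then show ?thesis by (simp only: finite.emptyI)
    qed
  qed
  \<comment> \<open>\<open>D\<close> collects the non-zero rows and \<open>\<phi>\<close> sends such
    a row to the column of its single 1. Injectivity of \<open>\<phi>\<close> allows the sum over
    rows to be reindexed by columns.\<close>
  define D where "D = {g \<in> ?F. \<exists>h\<in>?F. mul G g (ginv G h) \<in> U}"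
  have "\<exists>\<phi>. \<forall>g\<in>D. \<phi> g \<in> ?F \<and> mul G g (ginv G (\<phi> g)) \<in> U"
    by (rule bchoice) (auto simp: D_def)
  then obtain \<phi> where \<phi>: "\<And>g. g \<in> D \<Longrightarrow> \<phi> g \<in> ?F" "\<And>g. g \<in> D \<Longrightarrow> mul G g (ginv G (\<phi> g)) \<in> U"
    by blast
  have DF: "D \<subseteq> ?F" by (auto simp: D_def)
  have inj: "inj_on \<phi> D"
  proof (rule inj_onI)
    fix g k assume "g \<in> D" "k \<in> D" "\<phi> g = \<phi> k"
    then show "g = k" using left[of g "\<phi> g" k] \<phi> DF by (metis subsetD)
  qed
  have D: "conv G (indicator U) \<xi> g = \<xi> (\<phi> g)" if "g \<in> D" for g \<xi>
  proof -
    have "conv G (indicator U) \<xi> g = (\<Sum>\<^sub>\<infinity>h\<in>?F. indicator U (mul G g (ginv G h)) * \<xi> h)"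
      using that DF by (intro conv_src_fibre) auto
    also have "\<dots> = (\<Sum>\<^sub>\<infinity>h\<in>{\<phi> g}. indicator U (mul G g (ginv G h)) * \<xi> h)"
      by (rule infsum_cong_neutral)
        (use \<phi> that right DF in \<open>auto simp: indicator_def split: if_splits\<close>)
    finally show ?thesis using \<phi> that by simp
  qed
  have nD: "conv G (indicator U) \<xi> g = 0" if "g \<in> ?F - D" for g \<xi>
    using that by (auto simp: conv_src_fibre D_def indicator_def intro!: infsum_0)
  show "ell2_bounded G x (indicator U) 1"
    unfolding ell2_bounded_def
  proof (intro ballI conjI)
    fix \<xi> assume "\<xi> \<in> ell2 G x"
    then have s: "(\<lambda>h. (cmod (\<xi> h))\<^sup>2) summable_on ?F" by (simp add: ell2_def)
    have sD: "(\<lambda>h. (cmod (\<xi> h))\<^sup>2) summable_on \<phi> ` D"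
      by (rule summable_on_subset_banach[OF s]) (use \<phi> in auto)
    have "(\<lambda>g. (cmod (conv G (indicator U) \<xi> g))\<^sup>2) summable_on ?F \<longleftrightarrow>
        ((\<lambda>h. (cmod (\<xi> h))\<^sup>2) \<circ> \<phi>) summable_on D"
      by (rule summable_on_cong_neutral) (use D nD DF in auto)
    then show "(\<lambda>g. (cmod (conv G (indicator U) \<xi> g))\<^sup>2) summable_on ?F"
      using sD summable_on_reindex[OF inj] by blast
    have "(\<Sum>\<^sub>\<infinity>g\<in>?F. (cmod (conv G (indicator U) \<xi> g))\<^sup>2) = infsum ((\<lambda>h. (cmod (\<xi> h))\<^sup>2) \<circ> \<phi>) D"
      by (rule infsum_cong_neutral) (use D nD DF in auto)
    also have "\<dots> = (\<Sum>\<^sub>\<infinity>h\<in>\<phi> ` D. (cmod (\<xi> h))\<^sup>2)"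
      by (rule infsum_reindex[OF inj, symmetric])
    also have "\<dots> \<le> (\<Sum>\<^sub>\<infinity>h\<in>?F. (cmod (\<xi> h))\<^sup>2)"
      by (rule infsum_mono_neutral[OF sD s]) (use \<phi> in auto)
    finally show "(\<Sum>\<^sub>\<infinity>g\<in>?F. (cmod (conv G (indicator U) \<xi> g))\<^sup>2) \<le> 1 * (\<Sum>\<^sub>\<infinity>g\<in>?F. (cmod (\<xi> g))\<^sup>2)"
      by simp
  qed
qed

text \<open>The bound may depend on \<open>x\<close>, because \<open>bounded_ops\<close> is a
  condition on each fibre separately.\<close>

lemma steinberg_ell2_bounded:
  assumes "f \<in> steinberg_algebra G"
  shows "finite_rows G x f \<and> (\<exists>C. ell2_bounded G x f C)"
  using assms unfolding steinberg_algebra_def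
proof (induction rule: complex_span_induct)
  case zero
  have "conv G (\<lambda>g. 0) \<xi> = (\<lambda>g. 0)" for \<xi> by (auto simp: conv_def)
  then have "ell2_bounded G x (\<lambda>g. 0) 0" by (simp add: ell2_bounded_def)
  then show ?case by (auto simp: finite_rows_def)
next
  case (step c k h)
  then obtain C where h: "finite_rows G x h" "ell2_bounded G x h C" by blast
  have k: "finite_rows G x k" "ell2_bounded G x k 1"
    using step bisection_ell2_bounded by (auto simp: compact_open_bisection_def)
  have "finite_rows G x (\<lambda>g. c * k g + h g)"
    unfolding finite_rows_def
  proof
    fix g assume g: "g \<in> src_fibre G x"
    show "finite {l \<in> src_fibre G x. c * k (mul G g (ginv G l)) + h (mul G g (ginv G l)) \<noteq> 0}"
      by (rule finite_subset[of _ "{l \<in> src_fibre G x. k (mul G g (ginv G l)) \<noteq> 0} \<union>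
          {l \<in> src_fibre G x. h (mul G g (ginv G l)) \<noteq> 0}"])
        (use g k(1) h(1) in \<open>auto simp: finite_rows_def\<close>)
  qed
  \<comment> \<open>The constant comes from \<open>summable_add_sq\<close>, with bound 1 for the
    bisection and \<open>C\<close> for the rest.\<close>
  moreover have "ell2_bounded G x (\<lambda>g. c * k g + h g) (2 * (cmod c)\<^sup>2 + 2 * C)"
    unfolding ell2_bounded_def
  proof (rule ballI)
    fix \<xi> assume \<xi>: "\<xi> \<in> ell2 G x"
    let ?F = "src_fibre G x"
    let ?l = "\<lambda>g. (cmod (conv G (\<lambda>g. c * k g + h g) \<xi> g))\<^sup>2"
    let ?r = "\<lambda>g. (cmod (c * conv G k \<xi> g + conv G h \<xi> g))\<^sup>2"
    let ?n = "\<Sum>\<^sub>\<infinity>g\<in>?F. (cmod (\<xi> g))\<^sup>2"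
    have eq: "?l g = ?r g" if "g \<in> ?F" for g
      using conv_scale_add_left[OF k(1) h(1) that] by simp
    have K: "(\<lambda>g. (cmod (conv G k \<xi> g))\<^sup>2) summable_on ?F"
        "(\<Sum>\<^sub>\<infinity>g\<in>?F. (cmod (conv G k \<xi> g))\<^sup>2) \<le> ?n"
      and H: "(\<lambda>g. (cmod (conv G h \<xi> g))\<^sup>2) summable_on ?F"
        "(\<Sum>\<^sub>\<infinity>g\<in>?F. (cmod (conv G h \<xi> g))\<^sup>2) \<le> C * ?n"
      using k h \<xi> by (auto simp: ell2_bounded_def)
    have "?l summable_on ?F \<longleftrightarrow> ?r summable_on ?F"
      by (rule summable_on_cong) (rule eq)
    then have s: "?l summable_on ?F" using summable_add_sq(1)[OF K(1) H(1)] by blast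
    have "infsum ?l ?F = infsum ?r ?F"
      by (rule infsum_cong) (rule eq)
    also have "\<dots> \<le> 2 * (cmod c)\<^sup>2 * (\<Sum>\<^sub>\<infinity>g\<in>?F. (cmod (conv G k \<xi> g))\<^sup>2) +
        2 * (\<Sum>\<^sub>\<infinity>g\<in>?F. (cmod (conv G h \<xi> g))\<^sup>2)"
      by (rule summable_add_sq(2)[OF K(1) H(1)])
    also have "\<dots> \<le> 2 * (cmod c)\<^sup>2 * ?n + 2 * (C * ?n)"
      by (intro add_mono mult_left_mono K(2) H(2)) auto
    finally show "?l summable_on ?F \<and> infsum ?l ?F \<le> (2 * (cmod c)\<^sup>2 + 2 * C) * ?n"
      using s by (simp add: algebra_simps)
  qed
  ultimately show ?case by blast
qed

text \<open>The singular ideal lies in the completion, so an approximant must first be shown to act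
  by bounded operators on all fibres. Being in Connes' algebra, \<open>f\<close> then approximates
  itself.\<close>

lemma regular_rep_steinberg:
  assumes "f \<in> steinberg_algebra G"
  shows "regular_rep G f \<in> reduced_Cstar G"
proof -
  have "regular_rep G f \<in> (\<Pi>\<^sub>E x\<in>units G. bounded_ops G x)"
    unfolding regular_rep_def using conv_bounded_op steinberg_ell2_bounded[OF assms] by fastforce
  moreover have "reduced_norm G (\<lambda>x \<xi> h. regular_rep G f x \<xi> h - regular_rep G f x \<xi> h) \<le> 0"
    unfolding reduced_norm_def by (intro SUP_least) (simp add: ell2_norm_def)
  ultimately show ?thesis
    using assms steinberg_subset_connes unfolding reduced_Cstar_def
    by (force intro!: bexI[of _ f] simp: le_zero_eq)
qed

text \<open>The coefficient function of \<open>regular_rep G f\<close> is \<open>f\<close> itself on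
  arrows, so singularity becomes a purely topological condition.\<close>

lemma singular_ideal_iff:
  assumes "regular_rep G f \<in> reduced_Cstar G"
  shows "regular_rep G f \<in> singular_ideal G \<longleftrightarrow>
    arr_top G interior_of {g \<in> arrows G. f g \<noteq> 0} = {}"
proof -
  have "{g \<in> arrows G. coeff G (regular_rep G f) g \<noteq> 0} = {g \<in> arrows G. f g \<noteq> 0}"
    using coeff_regular_rep by auto
  then show ?thesis using assms by (simp add: singular_ideal_def)
qed

end


section \<open>C*-norms of functions supported on a bisection\<close>

context topological_groupoid
begin

text \<open>A term at \<open>g\<close> survives only if \<open>h\<close> and the inverse of
  \<open>mul G g (ginv G h)\<close> both lie in \<open>U\<close>. They have the same range, hence
  agree, which forces \<open>g\<close> to be the source of \<open>h\<close>; the term is then the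
  squared modulus of \<open>w h\<close>.\<close>

lemma conv_invol_unimodular:
  assumes U: "open_bisection G U"
    and w: "\<And>g. g \<in> U \<Longrightarrow> cmod (w g) = 1" "\<And>g. g \<notin> U \<Longrightarrow> w g = 0"
  shows "conv G (invol G w) w = indicator (src G ` U)"
proof
  fix g
  note inj = open_bisection_inj[OF U] and sub = open_bisection_subset[OF U]
  let ?t = "\<lambda>h. invol G w (mul G g (ginv G h)) * w h"
  show "conv G (invol G w) w g = indicator (src G ` U) g"
  proof (cases "g \<in> arrows G")
    case False
    then have "g \<notin> src G ` U" using sub src_closed by blast
    with False show ?thesis by (simp add: conv_def)
  next
    case g: True
    have unit: "g = src G h \<and> h \<in> U" if h: "h \<in> src_fibre G (src G g)" "?t h \<noteq> 0" for h
    proof -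
      have ha: "h \<in> arrows G" "src G g = src G h" using h by (auto simp: src_fibre_def)
      define p where "p = mul G g (ginv G h)"
      have p: "p \<in> arrows G" "rng G p = rng G g" "src G p = rng G h"
        using mul_ginv_closed[OF g ha] by (auto simp: p_def)
      have hU: "h \<in> U" using h(2) w(2) by fastforce
      have "ginv G p \<in> U"
        using h(2) w(2) p(1) by (fastforce simp: invol_def p_def)
      moreover have "rng G (ginv G p) = rng G h" using p by (simp add: rng_inv)
      ultimately have pe: "ginv G p = h" using inj(1) hU by (auto dest: inj_onD)
      have "g = mul G p h" using mul_ginv_cancel[OF g ha] by (simp add: p_def)
      also have "\<dots> = rng G p" using mul_inv[OF p(1)] pe by simp
      also have "\<dots> = src G h" using src_inv[OF p(1)] pe by simp
      finally show ?thesis using hU by simp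
    qed
    show ?thesis
    proof (cases "g \<in> src G ` U")
      case True
      then obtain h where h: "h \<in> U" "g = src G h" by auto
      have ha: "h \<in> arrows G" using h sub by blast
      have gu: "g \<in> units G" using src_in_units[OF ha] h by simp
      then have sg: "src G g = g" by (rule src_unit)
      have "mul G g (ginv G h) = ginv G h"
        using mul_rng[OF inv_closed[OF ha]] rng_inv[OF ha] h by simp
      then have th: "?t h = 1"
        using ha w(1)[OF h(1)] by (simp add: invol_def inv_closed ginv_ginv complex_norm_square mult.commute)
          (metis complex_norm_square mult.commute of_real_1 power_one)
      have "conv G (invol G w) w g = (\<Sum>\<^sub>\<infinity>k\<in>src_fibre G g. ?t k)"
        using g sg by (simp add: conv_def)
      also have "\<dots> = (\<Sum>\<^sub>\<infinity>k\<in>{h}. ?t k)"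
      proof (rule infsum_cong_neutral)
        fix k assume k: "k \<in> src_fibre G g - {h}"
        \<comment> \<open>A second surviving arrow would share its source \<open>g\<close> with
          \<open>h\<close>.\<close>
        show "?t k = 0"
        proof (rule ccontr)
          assume "?t k \<noteq> 0"
          then have "g = src G k" "k \<in> U" using unit[of k] k sg by auto
          then show False using inj_onD[OF inj(2)] h k by blast
        qed
      qed (use ha h in \<open>auto simp: src_fibre_def\<close>)
      finally show ?thesis using th True by simp
    next
      case False
      have "?t h = 0" if "h \<in> src_fibre G (src G g)" for h
        using unit[OF that] False by blast
      then show ?thesis using g False by (simp add: conv_def infsum_0)
    qed
  qed
qed

end

section \<open>Topology of the unit space of an etale groupoid\<close>

context etale_groupoid
begin

text \<open>Around \<open>x\<close> the map \<open>src\<close> is injective on some open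
  \<open>U\<close>. If \<open>g\<close> and its source both lie in \<open>U\<close>, they have the
  same source, so they coincide and \<open>g\<close> is a unit.\<close>

lemma units_open: "openin (arr_top G) (units G)"
proof (subst openin_subopen, intro ballI)
  fix x assume x: "x \<in> units G"
  then have xa: "x \<in> arrows G" using units_subset by blast
  then obtain U where U: "openin (arr_top G) U" "x \<in> U"
    "homeomorphic_map (subtopology (arr_top G) U) (subtopology (unit_top G) (src G ` U)) (src G)"
    using src_local_homeo unfolding local_homeomorphism_map_def by blast
  have sub: "U \<subseteq> arrows G" using U(1) openin_subset by blast
  then have inj: "inj_on (src G) U"
    using homeomorphic_imp_injective_map[OF U(3)] by (simp add: Int_absorb1)
  define V where "V = U \<inter> {g \<in> arrows G. src G g \<in> units G \<inter> U}"
  have "openin (unit_top G) (units G \<inter> U)"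
    unfolding unit_top_def using U(1) by (simp add: openin_subtopology_Int2)
  then have "openin (arr_top G) V"
    unfolding V_def by (intro openin_Int[OF U(1)] openin_continuous_map_preimage[OF continuous_src])
  moreover have "x \<in> V"
    using x xa U(2) src_unit by (simp add: V_def)
  moreover have "V \<subseteq> units G"
  proof
    fix g assume g: "g \<in> V"
    then have "src G (src G g) = src G g" using src_unit by (auto simp: V_def)
    then have "src G g = g"
      by (rule inj_onD[OF inj]) (use g in \<open>auto simp: V_def\<close>)
    then show "g \<in> units G" using g src_in_units[of g] sub by (auto simp: V_def)
  qed
  ultimately show "\<exists>T. openin (arr_top G) T \<and> x \<in> T \<and> T \<subseteq> units G" by blast
qed

lemma openin_unit_top: "openin (unit_top G) A \<longleftrightarrow> openin (arr_top G) A \<and> A \<subseteq> units G"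
  unfolding unit_top_def by (rule openin_open_subtopology[OF units_open])

lemma compactin_unit_top: "compactin (unit_top G) A \<longleftrightarrow> compactin (arr_top G) A \<and> A \<subseteq> units G"
  unfolding unit_top_def by (rule compactin_subtopology)

text \<open>Closedness comes from compactness in the Hausdorff unit space. In the arrow space a
  compact open bisection need not be closed, which is why functions are moved to the unit
  space.\<close>

lemma compact_open_bisection_src_image:
  assumes "compact_open_bisection G U"
  shows "openin (unit_top G) (src G ` U)" "compactin (unit_top G) (src G ` U)"
    "closedin (unit_top G) (src G ` U)"
proof -
  show "openin (unit_top G) (src G ` U)"
    using assms local_homeomorphism_open_map[OF src_local_homeo]
    by (auto simp: open_map_def compact_open_bisection_def open_bisection_def)
  show "compactin (unit_top G) (src G ` U)"
    using assms image_compactin continuous_src by (auto simp: compact_open_bisection_def)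
  then show "closedin (unit_top G) (src G ` U)"
    using Hausdorff_units by (rule compactin_imp_closedin[rotated])
qed

text \<open>\<open>rng\<close> and \<open>src\<close> both restrict to the identity on a set of
  units.\<close>

lemma compact_open_bisection_units:
  assumes A: "openin (unit_top G) A" "compactin (unit_top G) A"
  shows "compact_open_bisection G A"
proof -
  have Au: "A \<subseteq> units G" "openin (arr_top G) A" using A(1) openin_unit_top by auto
  have im: "rng G ` A = A" "src G ` A = A" using Au rng_unit src_unit by force+
  have top: "subtopology (unit_top G) A = subtopology (arr_top G) A"
    using Au by (simp add: unit_top_def subtopology_subtopology Int_absorb1)
  have "homeomorphic_map (subtopology (arr_top G) A) (subtopology (arr_top G) A) f"
    if "\<And>x. x \<in> A \<Longrightarrow> f x = x" for f
    by (rule homeomorphic_map_eq[OF homeomorphic_map_id[THEN iffD2, OF refl]]) (use that in auto)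
  then show ?thesis
    using A(2) Au rng_unit src_unit
    unfolding compact_open_bisection_def open_bisection_def im top compactin_unit_top by blast
qed

text \<open>Openness of the preimage keeps the intersection a bisection, closedness keeps it
  compact. These are the pieces from which the Steinberg approximant is built.\<close>

lemma compact_open_bisection_src_preimage:
  assumes U: "compact_open_bisection G U" and V: "openin (unit_top G) V" "closedin (unit_top G) V"
  shows "compact_open_bisection G (U \<inter> {g \<in> arrows G. src G g \<in> V})"
proof -
  have "openin (arr_top G) {g \<in> arrows G. src G g \<in> V}"
    using continuous_src V(1) by (rule openin_continuous_map_preimage)
  moreover have "closedin (arr_top G) {g \<in> arrows G. src G g \<in> V}"
    using continuous_src V(2) by (rule closedin_continuous_map_preimage)
  ultimately show ?thesis
    using U open_bisection_open_subset[of U "U \<inter> {g \<in> arrows G. src G g \<in> V}"]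
    unfolding compact_open_bisection_def
    by (simp add: open_bisection_open openin_Int compact_Int_closedin)
qed

text \<open>Transport along the inverse of \<open>src\<close> on \<open>U\<close>, then extension by
  zero off the clopen set of sources. Summands living on different bisections can then be sampled at
  common units.\<close>

lemma bisection_function_descends:
  assumes U: "compact_open_bisection G U"
    and h: "continuous_map (subtopology (arr_top G) U) euclidean (h :: 'g \<Rightarrow> complex)"
  obtains F where "continuous_map (unit_top G) euclidean F" "\<And>g. g \<in> U \<Longrightarrow> F (src G g) = h g"
proof -
  have U': "open_bisection G U" using U by (simp add: compact_open_bisection_def)
  let ?A = "src G ` U"
  obtain t where t: "homeomorphic_maps (subtopology (arr_top G) U) (subtopology (unit_top G) ?A) (src G) t"
    using U' homeomorphic_map_maps unfolding open_bisection_def by blast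
  let ?F = "\<lambda>x. if x \<in> ?A then (h \<circ> t) x else 0"
  have "continuous_map (subtopology (unit_top G) ?A) euclidean (h \<circ> t)"
    using t h continuous_map_compose unfolding homeomorphic_maps_def by blast
  then have "continuous_map (unit_top G) euclidean ?F"
    by (intro continuous_map_indicator_clopen compact_open_bisection_src_image[OF U])
  moreover have "?F (src G g) = h g" if "g \<in> U" for g
  proof -
    have "g \<in> topspace (subtopology (arr_top G) U)"
      using that open_bisection_subset[OF U'] by auto
    then show ?thesis using t that unfolding homeomorphic_maps_def by auto
  qed
  ultimately show ?thesis by (rule that)
qed

section \<open>Estimates valid in every C*-norm\<close>

context
  fixes N :: "('g \<Rightarrow> complex) \<Rightarrow> real"
  assumes N: "Cstar_norm_on_connes G N"
begin

lemma Cstar_norm_scale: "f \<in> connes_algebra G \<Longrightarrow> N (\<lambda>g. c * f g) = cmod c * N f"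
  using N unfolding Cstar_norm_on_connes_def by blast

lemma Cstar_norm_add:
  "f \<in> connes_algebra G \<Longrightarrow> h \<in> connes_algebra G \<Longrightarrow> N (\<lambda>g. f g + h g) \<le> N f + N h"
  using N unfolding Cstar_norm_on_connes_def by blast

lemma Cstar_norm_sum:
  assumes "finite I" "\<And>i. i \<in> I \<Longrightarrow> d i \<in> connes_algebra G"
  shows "N (\<lambda>g. \<Sum>i\<in>I. d i g) \<le> (\<Sum>i\<in>I. N (d i))"
  using assms
proof (induction I rule: finite_induct)
  case empty
  have "(\<lambda>g. 0) \<in> connes_algebra G" by (simp add: connes_algebra_def complex_span_zero)
  then have "N (\<lambda>g. 0) = 0" using N unfolding Cstar_norm_on_connes_def by blast
  then show ?case by simp
next
  case (insert i I)
  have "(\<lambda>g. \<Sum>i\<in>I. d i g) \<in> connes_algebra G"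
    using insert unfolding connes_algebra_def by (intro complex_span_sum) auto
  then have "N (\<lambda>g. d i g + (\<Sum>i\<in>I. d i g)) \<le> N (d i) + N (\<lambda>g. \<Sum>i\<in>I. d i g)"
    using insert by (intro Cstar_norm_add) auto
  then show ?case using insert by (auto intro: order_trans)
qed

text \<open>Let \<open>p\<close> be the indicator of the sources of \<open>U\<close>. By the
  C*-identity \<open>N p\<close> is the square of both \<open>N w\<close> and \<open>N p\<close>, so
  it is 0 or 1.\<close>

lemma Cstar_norm_unimodular:
  assumes U: "compact_open_bisection G U"
    and w: "continuous_map (subtopology (arr_top G) U) euclidean w"
      "\<And>g. g \<in> U \<Longrightarrow> cmod (w g) = 1" "\<And>g. g \<notin> U \<Longrightarrow> w g = 0"
  shows "N w \<le> 1"
proof -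
  let ?K = "src G ` U"
  have K: "compact_open_bisection G ?K"
    using compact_open_bisection_src_image[OF U] by (intro compact_open_bisection_units)
  have wc: "w \<in> connes_algebra G" using connes_algebraI[OF U] w by blast
  have Kc: "indicator ?K \<in> connes_algebra G"
    using indicator_in_steinberg[OF K] steinberg_subset_connes by blast
  have sq: "N (conv G (invol G f) f) = (N f)\<^sup>2" if "f \<in> connes_algebra G" for f
    using N that unfolding Cstar_norm_on_connes_def by blast
  \<comment> \<open>Lets \<open>conv_invol_unimodular\<close> apply to \<open>?K\<close> as a
    bisection in its own right, which yields the idempotent relation.\<close>
  have "src G ` ?K = ?K"
    using open_bisection_subset[of U] U src_in_units src_unit
    by (force simp: compact_open_bisection_def image_image)
  then have "conv G (invol G (indicator ?K)) (indicator ?K) = indicator ?K"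
    using K conv_invol_unimodular[of ?K "indicator ?K"] by (simp add: compact_open_bisection_def)
  then have "(N (indicator ?K))\<^sup>2 = N (indicator ?K)" using sq[OF Kc] by simp
  then have "N (indicator ?K) \<le> 1" by (auto simp: power2_eq_square)
  moreover have "(N w)\<^sup>2 = N (indicator ?K)"
    using sq[OF wc] conv_invol_unimodular[of U w] U w(2,3) by (simp add: compact_open_bisection_def)
  ultimately show ?thesis by (simp add: power2_le_imp_le)
qed

text \<open>A real function \<open>d\<close> with \<open>\<bar>d\<bar> \<le> 1\<close> is the mean of the unimodular functions
  \<open>d \<plusminus> i sqrt (1 - d\<^sup>2)\<close>.\<close>

lemma Cstar_norm_real_le:
  assumes U: "compact_open_bisection G U"
    and d: "continuous_map (subtopology (arr_top G) U) euclidean d"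
      "\<And>g. g \<in> U \<Longrightarrow> \<bar>d g\<bar> \<le> (1 :: real)" "\<And>g. g \<notin> U \<Longrightarrow> d g = 0"
  shows "(\<lambda>g. complex_of_real (d g)) \<in> connes_algebra G" "N (\<lambda>g. complex_of_real (d g)) \<le> 1"
proof -
  define w where "w = (\<lambda>s g. if g \<in> U then complex_of_real (d g) +
    s * \<i> * complex_of_real (sqrt (1 - (d g)\<^sup>2)) else 0)"
  have cont: "continuous_map (subtopology (arr_top G) U) euclidean (w s)" for s
  proof -
    \<comment> \<open>\<open>sqrt\<close> is total and continuous on all reals, so on
      \<open>U\<close> the function \<open>w s\<close> is a continuous function of
      \<open>d\<close>.\<close>
    have "continuous_map euclidean euclidean
        (\<lambda>r. complex_of_real r + s * \<i> * complex_of_real (sqrt (1 - r\<^sup>2)))"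
      by (auto intro!: continuous_intros)
    from continuous_map_compose[OF d(1) this] show ?thesis
      by (rule continuous_map_eq) (auto simp: w_def)
  qed
  have mod: "cmod (w s g) = 1" if "g \<in> U" "s = 1 \<or> s = -1" for s g
  proof -
    have "(d g)\<^sup>2 \<le> 1" using d(2)[OF that(1)] by (simp add: abs_square_le_1)
    then show ?thesis using that by (auto simp: w_def cmod_def)
  qed
  have wc: "w s \<in> connes_algebra G" for s
    by (rule connes_algebraI[OF U cont]) (simp add: w_def)
  have wN: "N (w s) \<le> 1" if "s = 1 \<or> s = -1" for s
    by (rule Cstar_norm_unimodular[OF U cont]) (use that mod in \<open>auto simp: w_def\<close>)
  have eq: "(\<lambda>g. complex_of_real (d g)) = (\<lambda>g. 1/2 * w 1 g + 1/2 * w (-1) g)"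
    using d(3) by (auto simp: w_def fun_eq_iff complex_eq_iff)
  have half: "(\<lambda>g. 1/2 * w s g) \<in> connes_algebra G" for s
    using wc unfolding connes_algebra_def by (rule complex_span_scale)
  show "(\<lambda>g. complex_of_real (d g)) \<in> connes_algebra G"
    unfolding eq using half unfolding connes_algebra_def by (intro complex_span_add)
  have "N (\<lambda>g. 1/2 * w 1 g + 1/2 * w (-1) g) \<le> N (\<lambda>g. 1/2 * w 1 g) + N (\<lambda>g. 1/2 * w (-1) g)"
    by (rule Cstar_norm_add[OF half half])
  also have "\<dots> = 1/2 * N (w 1) + 1/2 * N (w (-1))"
    using Cstar_norm_scale[OF wc[of 1], of "1/2"] Cstar_norm_scale[OF wc[of "-1"], of "1/2"] by simp
  also have "\<dots> \<le> 1" using wN[of 1] wN[of "-1"] by simp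
  finally show "N (\<lambda>g. complex_of_real (d g)) \<le> 1" unfolding eq .
qed

text \<open>Real and imaginary part, divided by \<open>M\<close>, fall under
  \<open>Cstar_norm_real_le\<close>, and each contributes at most \<open>M\<close>.\<close>

lemma Cstar_norm_bisection_le:
  assumes U: "compact_open_bisection G U"
    and d: "continuous_map (subtopology (arr_top G) U) euclidean d"
      "\<And>g. g \<in> U \<Longrightarrow> cmod (d g) \<le> M" "\<And>g. g \<notin> U \<Longrightarrow> d g = 0"
    and M: "M > 0"
  shows "N d \<le> 2 * M"
proof -
  define p where "p = (\<lambda>g. Re (d g) / M)"
  define q where "q = (\<lambda>g. Im (d g) / M)"
  have "continuous_map euclidean euclidean (\<lambda>z. Re z / M)"
    "continuous_map euclidean euclidean (\<lambda>z. Im z / M)"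
    using M by (auto intro!: continuous_intros)
  from this[THEN continuous_map_compose[OF d(1)]]
  have c: "continuous_map (subtopology (arr_top G) U) euclidean p"
    "continuous_map (subtopology (arr_top G) U) euclidean q"
    by (simp_all add: p_def q_def comp_def)
  have b: "\<bar>p g\<bar> \<le> 1" "\<bar>q g\<bar> \<le> 1" if "g \<in> U" for g
    using d(2)[OF that] abs_Re_le_cmod[of "d g"] abs_Im_le_cmod[of "d g"] M
    by (auto simp: p_def q_def)
  have z: "p g = 0" "q g = 0" if "g \<notin> U" for g using d(3)[OF that] by (auto simp: p_def q_def)
  note P = Cstar_norm_real_le[OF U c(1) b(1) z(1)] and Q = Cstar_norm_real_le[OF U c(2) b(2) z(2)]
  have Pc: "(\<lambda>g. complex_of_real M * complex_of_real (p g)) \<in> connes_algebra G"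
    and Qc: "(\<lambda>g. \<i> * complex_of_real M * complex_of_real (q g)) \<in> connes_algebra G"
    using P(1) Q(1) unfolding connes_algebra_def by (simp_all add: complex_span_scale)
  have "d = (\<lambda>g. complex_of_real M * complex_of_real (p g) + \<i> * complex_of_real M * complex_of_real (q g))"
    using M by (auto simp: p_def q_def fun_eq_iff complex_eq_iff)
  then have "N d \<le> N (\<lambda>g. complex_of_real M * complex_of_real (p g)) +
      N (\<lambda>g. \<i> * complex_of_real M * complex_of_real (q g))"
    using Cstar_norm_add[OF Pc Qc] by simp
  also have "\<dots> = M * N (\<lambda>g. complex_of_real (p g)) + M * N (\<lambda>g. complex_of_real (q g))"
    using M Cstar_norm_scale[OF P(1), of "complex_of_real M"]
      Cstar_norm_scale[OF Q(1), of "\<i> * complex_of_real M"] by (simp add: norm_mult)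
  also have "\<dots> \<le> M * 1 + M * 1"
    using M P(2) Q(2) by (intro add_mono mult_left_mono) auto
  finally show ?thesis by simp
qed

end

end


section \<open>Approximation of singular functions\<close>

context ample_groupoid
begin

text \<open>Finitely many compact open bisections inside \<open>U\<close> cover the support. Unions
  of bisections are not bisections in general, but this one is an open subset of
  \<open>U\<close>.\<close>

lemma compact_support_bisection:
  assumes U: "open_bisection G U" and f: "Cc_on (arr_top G) U f" "\<And>g. g \<notin> U \<Longrightarrow> f g = 0"
  obtains V where "compact_open_bisection G V" "continuous_map (subtopology (arr_top G) V) euclidean f"
    "\<And>g. g \<notin> V \<Longrightarrow> f g = 0"
proof -
  let ?K = "subtopology (arr_top G) U closure_of {g \<in> U. f g \<noteq> 0}"
  let ?B = "{B. compact_open_bisection G B \<and> B \<subseteq> U}"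
  have sub: "U \<subseteq> arrows G" using U by (rule open_bisection_subset)
  have K: "compactin (arr_top G) ?K" "?K \<subseteq> U"
    using f(1) by (auto simp: Cc_on_def compactin_subtopology)
  have "?K \<subseteq> \<Union>?B"
    using K(2) compact_open_bisection_base[OF open_bisection_open[OF U]] by blast
  moreover have "openin (arr_top G) B" if "B \<in> ?B" for B
    using that open_bisection_open by (auto simp: compact_open_bisection_def)
  ultimately obtain \<F> where \<F>: "finite \<F>" "\<F> \<subseteq> ?B" "?K \<subseteq> \<Union>\<F>"
    using K(1) unfolding compactin_def by (metis (no_types, lifting))
  have V: "openin (arr_top G) (\<Union>\<F>)" "\<Union>\<F> \<subseteq> U" "compactin (arr_top G) (\<Union>\<F>)"
    using \<F> open_bisection_open
    by (auto simp: compact_open_bisection_def intro!: compactin_Union openin_Union)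
  show ?thesis
  proof
    show "compact_open_bisection G (\<Union>\<F>)"
      using V U open_bisection_open_subset by (auto simp: compact_open_bisection_def)
    show "continuous_map (subtopology (arr_top G) (\<Union>\<F>)) euclidean f"
      by (rule continuous_map_from_subtopology_mono[OF _ V(2)]) (use f(1) in \<open>simp add: Cc_on_def\<close>)
    have "{g \<in> U. f g \<noteq> 0} \<subseteq> ?K"
      using sub by (intro closure_of_subset) auto
    then show "f g = 0" if "g \<notin> \<Union>\<F>" for g
      by (cases "g \<in> U") (use that f(2)[of g] \<F>(3) in auto)
  qed
qed

text \<open>The generating functions serve as their own indices, which explains the type of
  \<open>I\<close>; the scalars are absorbed into \<open>h\<close>.\<close>

lemma connes_decomposition:
  assumes "f \<in> connes_algebra G"
  obtains I :: "('g \<Rightarrow> complex) set" and U h where "finite I" "\<And>i. i \<in> I \<Longrightarrow> compact_open_bisection G (U i)"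
    "\<And>i. i \<in> I \<Longrightarrow> continuous_map (subtopology (arr_top G) (U i)) euclidean (h i)"
    "\<And>i g. i \<in> I \<Longrightarrow> g \<notin> U i \<Longrightarrow> h i g = (0 :: complex)"
    "f = (\<lambda>g. \<Sum>i\<in>I. h i g)"
proof -
  obtain I c where I: "finite I" "f = (\<lambda>g. \<Sum>k\<in>I. c k * k g)"
    "\<And>k. k \<in> I \<Longrightarrow> \<exists>U. open_bisection G U \<and> Cc_on (arr_top G) U k \<and> (\<forall>g. g \<notin> U \<longrightarrow> k g = 0)"
    using assms unfolding connes_algebra_def complex_span_def by auto
  have "\<forall>k\<in>I. \<exists>V. compact_open_bisection G V \<and>
      continuous_map (subtopology (arr_top G) V) euclidean k \<and> (\<forall>g. g \<notin> V \<longrightarrow> k g = 0)"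
    using I(3) compact_support_bisection by metis
  then obtain U where U: "\<And>k. k \<in> I \<Longrightarrow> compact_open_bisection G (U k)"
    "\<And>k. k \<in> I \<Longrightarrow> continuous_map (subtopology (arr_top G) (U k)) euclidean k"
    "\<And>k g. k \<in> I \<Longrightarrow> g \<notin> U k \<Longrightarrow> k g = 0"
    by metis
  show ?thesis
  proof (rule that[of I U "\<lambda>k g. c k * k g"])
    show "continuous_map (subtopology (arr_top G) (U i)) euclidean (\<lambda>g. c i * i g)" if "i \<in> I" for i
      using continuous_map_compose[OF U(2)[OF that], of euclidean "\<lambda>z. c i * z"]
      by (simp add: comp_def continuous_intros)
  qed (use I U in auto)
qed

text \<open>Compact open sets of units are closed by Hausdorffness, so a finite subcover can be made
  disjoint. In the result \<open>y\<close> is only a label: \<open>V y\<close> stays inside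
  \<open>W y\<close> but may have lost the point \<open>y\<close>.\<close>

lemma unit_space_partition:
  assumes K: "compactin (unit_top G) K"
    and W: "\<And>y. y \<in> K \<Longrightarrow> openin (unit_top G) (W y) \<and> y \<in> W y"
  obtains Y V where "finite Y" "Y \<subseteq> K" "disjoint_family_on V Y" "K \<subseteq> (\<Union>y\<in>Y. V y)"
    "\<And>y. y \<in> Y \<Longrightarrow> openin (unit_top G) (V y)" "\<And>y. y \<in> Y \<Longrightarrow> closedin (unit_top G) (V y)"
    "\<And>y. y \<in> Y \<Longrightarrow> V y \<subseteq> W y"
proof -
  have "\<exists>B. openin (unit_top G) B \<and> closedin (unit_top G) B \<and> y \<in> B \<and> B \<subseteq> W y" if y: "y \<in> K" for y
  proof -
    have Wy: "openin (arr_top G) (W y)" "W y \<subseteq> units G" "y \<in> W y"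
      using W[OF y] openin_unit_top by simp_all
    obtain B where B: "compact_open_bisection G B" "y \<in> B" "B \<subseteq> W y"
      using compact_open_bisection_base[OF Wy(1,3)] by metis
    have "openin (arr_top G) B" "compactin (arr_top G) B"
      using B(1) open_bisection_open by (simp_all add: compact_open_bisection_def)
    then have "openin (unit_top G) B" "compactin (unit_top G) B"
      using B(3) Wy(2) openin_unit_top compactin_unit_top by simp_all
    then show ?thesis using B compactin_imp_closedin[OF Hausdorff_units] by blast
  qed
  then obtain B where B: "\<And>y. y \<in> K \<Longrightarrow> openin (unit_top G) (B y)"
    "\<And>y. y \<in> K \<Longrightarrow> closedin (unit_top G) (B y)" "\<And>y. y \<in> K \<Longrightarrow> y \<in> B y"
    "\<And>y. y \<in> K \<Longrightarrow> B y \<subseteq> W y"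
    by metis
  have "\<exists>\<F>. finite \<F> \<and> \<F> \<subseteq> B ` K \<and> K \<subseteq> \<Union>\<F>"
  proof (rule compactinD[OF K])
    show "openin (unit_top G) C" if "C \<in> B ` K" for C using that B(1) by auto
    show "K \<subseteq> \<Union>(B ` K)" using B(3) by auto
  qed
  then obtain Y where Y: "finite Y" "Y \<subseteq> K" "K \<subseteq> \<Union>(B ` Y)"
    by (metis finite_subset_image)
  obtain V where V: "\<forall>y\<in>Y. openin (unit_top G) (V y) \<and> closedin (unit_top G) (V y) \<and> V y \<subseteq> B y"
    "disjoint_family_on V Y" "(\<Union>y\<in>Y. V y) = (\<Union>y\<in>Y. B y)"
    using disjoint_clopen_refinement[OF Y(1), of "unit_top G" B] B Y by blast
  have VW: "V y \<subseteq> W y" if y: "y \<in> Y" for y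
  proof -
    have "y \<in> K" using y Y(2) by blast
    then have "V y \<subseteq> B y" "B y \<subseteq> W y" using V(1) B(4) y by simp_all
    then show ?thesis by simp
  qed
  show ?thesis
    by (rule that[OF Y(1,2) V(2)]) (use V Y(3) VW in simp_all)
qed

text \<open>Singularity is expressed through interiors of non-vanishing sets, so the construction
  deals with functions only; operators return in the final theorem.\<close>

lemma singular_steinberg_approximation:
  assumes N: "Cstar_norm_on_connes G N"
    and f: "f \<in> connes_algebra G" "arr_top G interior_of {g \<in> arrows G. f g \<noteq> 0} = {}"
    and \<delta>: "\<delta> > 0"
  shows "\<exists>a\<in>steinberg_algebra G. arr_top G interior_of {g \<in> arrows G. a g \<noteq> 0} = {} \<and>
    N (\<lambda>g. f g - a g) < \<delta>"
proof -
  obtain I :: "('g \<Rightarrow> complex) set" and U h where I: "finite I"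
    and U: "\<And>i. i \<in> I \<Longrightarrow> compact_open_bisection G (U i)"
    and h: "\<And>i. i \<in> I \<Longrightarrow> continuous_map (subtopology (arr_top G) (U i)) euclidean (h i)"
      "\<And>i g. i \<in> I \<Longrightarrow> g \<notin> U i \<Longrightarrow> h i g = 0"
    and fh: "f = (\<lambda>g. \<Sum>i\<in>I. h i g)"
    by (rule connes_decomposition[OF f(1)]) blast
  have "\<forall>i\<in>I. \<exists>F. continuous_map (unit_top G) euclidean F \<and> (\<forall>g\<in>U i. F (src G g) = h i g)"
    using bisection_function_descends[OF U h(1)] by metis
  then obtain F where F: "\<And>i. i \<in> I \<Longrightarrow> continuous_map (unit_top G) euclidean (F i)"
    "\<And>i g. i \<in> I \<Longrightarrow> g \<in> U i \<Longrightarrow> F i (src G g) = h i g"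
    by metis
  have Uo: "openin (arr_top G) (U i)" "U i \<subseteq> arrows G" if "i \<in> I" for i
    using U[OF that] open_bisection_open open_bisection_subset by (auto simp: compact_open_bisection_def)
  \<comment> \<open>Each of the \<open>card I\<close> summands will cost at most
    \<open>2 * \<epsilon>\<close>. The added 1 makes the final inequality strict and covers empty
    \<open>I\<close>.\<close>
  define \<epsilon> where "\<epsilon> = \<delta> / (2 * (real (card I) + 1))"
  have \<epsilon>: "\<epsilon> > 0" using \<delta> by (simp add: \<epsilon>_def)
  define K where "K = (\<Union>i\<in>I. src G ` U i)"
  have K: "compactin (unit_top G) K"
    unfolding K_def using I U compact_open_bisection_src_image(2) by (intro compactin_Union) auto
  then have Ku: "K \<subseteq> units G" using compactin_unit_top by blast
  \<comment> \<open>The balls serve the norm estimate, the second family serves singularity. It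
    ranges over all subsets of \<open>I\<close>, as any of them may be the set of bisections through
    an arrow over \<open>y\<close>.\<close>
  define W where "W = (\<lambda>y. units G \<inter> (\<Inter>i\<in>I. {x \<in> units G. F i x \<in> ball (F i y) \<epsilon>}) \<inter>
    (\<Inter>S\<in>{S \<in> Pow I. (\<Sum>i\<in>S. F i y) \<noteq> 0}. {x \<in> units G. (\<Sum>i\<in>S. F i x) \<in> - {0}}))"
  have "openin (unit_top G) (W y) \<and> y \<in> W y" if "y \<in> K" for y
  proof
    have 1: "openin (unit_top G) {x \<in> units G. F i x \<in> ball (F i y) \<epsilon>}" if "i \<in> I" for i
      using openin_continuous_map_preimage[OF F(1)[OF that], of "ball (F i y) \<epsilon>"]
      by (simp add: topspace_unit_top)
    have 2: "openin (unit_top G) {x \<in> units G. (\<Sum>i\<in>S. F i x) \<in> - {0}}" if "S \<in> Pow I" for S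
    proof -
      have "continuous_map (unit_top G) euclidean (\<lambda>x. \<Sum>i\<in>S. F i x)"
        using that I F(1) by (intro continuous_map_sum) (auto intro: finite_subset)
      from openin_continuous_map_preimage[OF this, of "- {0}"] show ?thesis
        by (simp add: topspace_unit_top open_Compl)
    qed
    have "openin (unit_top G) (units G)" by (metis openin_topspace topspace_unit_top)
    then show "openin (unit_top G) (W y)"
      unfolding W_def using 1 2 I by (intro openin_Int_Inter) auto
    show "y \<in> W y" using that Ku \<epsilon> by (auto simp: W_def)
  qed
  from unit_space_partition[OF K this]
  obtain Y V where Y: "finite Y" "Y \<subseteq> K" "disjoint_family_on V Y" "K \<subseteq> (\<Union>y\<in>Y. V y)"
    and V: "\<And>y. y \<in> Y \<Longrightarrow> openin (unit_top G) (V y)" "\<And>y. y \<in> Y \<Longrightarrow> closedin (unit_top G) (V y)"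
      "\<And>y. y \<in> Y \<Longrightarrow> V y \<subseteq> W y"
    by metis
  \<comment> \<open>The step function that samples \<open>F i\<close> at the labels
    \<open>y\<close>.\<close>
  define \<phi> where "\<phi> = (\<lambda>i x. \<Sum>y\<in>Y. F i y * indicator (V y) x)"
  have \<phi>: "\<phi> i x = F i y" if "y \<in> Y" "x \<in> V y" for i x y
  proof -
    have "\<phi> i x = (\<Sum>z\<in>{y}. F i z * indicator (V z) x)"
      unfolding \<phi>_def using Y(1,3) that
      by (intro sum.mono_neutral_right) (auto simp: disjoint_family_on_def indicator_def)
    then show ?thesis using that by simp
  qed
  have \<phi>c: "continuous_map (unit_top G) euclidean (\<phi> i)" for i
    unfolding \<phi>_def
  proof (intro continuous_map_sum Y(1))
    fix y assume y: "y \<in> Y"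
    have "continuous_map (unit_top G) euclidean (\<lambda>x. if x \<in> V y then F i y else 0)"
      by (rule continuous_map_indicator_clopen) (use V y in auto)
    then show "continuous_map (unit_top G) euclidean (\<lambda>x. F i y * indicator (V y) x)"
      by (rule continuous_map_eq) auto
  qed
  let ?P = "\<lambda>i y. U i \<inter> {g \<in> arrows G. src G g \<in> V y}"
  define a where "a = (\<lambda>g. \<Sum>i\<in>I. \<Sum>y\<in>Y. F i y * indicator (?P i y) g)"
  \<comment> \<open>Puts \<open>a\<close> into the same form as \<open>f\<close> below: both are
    sums over the bisections through \<open>g\<close>, evaluated at the source of
    \<open>g\<close>.\<close>
  have a_alt: "a g = (\<Sum>i\<in>{i \<in> I. g \<in> U i}. \<phi> i (src G g))" for g
  proof -
    have "(\<Sum>y\<in>Y. F i y * indicator (?P i y) g) = (if g \<in> U i then \<phi> i (src G g) else 0)"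
      if "i \<in> I" for i
      using Uo(2)[OF that] by (auto simp: \<phi>_def indicator_def intro!: sum.cong)
    then have "a g = (\<Sum>i\<in>I. if g \<in> U i then \<phi> i (src G g) else 0)"
      unfolding a_def by (intro sum.cong) auto
    then show ?thesis using I by (simp add: sum.inter_filter)
  qed
  have f_alt: "f g = (\<Sum>i\<in>{i \<in> I. g \<in> U i}. F i (src G g))" for g
  proof -
    have "f g = (\<Sum>i\<in>I. if g \<in> U i then F i (src G g) else 0)"
      unfolding fh using F(2) h(2) by (intro sum.cong) auto
    then show ?thesis using I by (simp add: sum.inter_filter)
  qed
  have st: "a \<in> steinberg_algebra G"
    unfolding a_def steinberg_algebra_def
  proof (intro complex_span_sum I Y(1) complex_span_scale_base)
    fix i y assume "i \<in> I" "y \<in> Y"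
    then have "compact_open_bisection G (?P i y)"
      by (intro compact_open_bisection_src_preimage U V)
    then show "indicator (?P i y) \<in> {indicator U | U. compact_open_bisection G U}" by blast
  qed

  have sing: "arr_top G interior_of {g \<in> arrows G. a g \<noteq> 0} = {}"
  proof (rule ccontr)
    let ?O = "arr_top G interior_of {g \<in> arrows G. a g \<noteq> 0}"
    assume "?O \<noteq> {}"
    then obtain g where g: "g \<in> ?O" by blast
    have O: "?O \<subseteq> {g \<in> arrows G. a g \<noteq> 0}" by (rule interior_of_subset)
    \<comment> \<open>An empty index set would give \<open>a g = 0\<close>.\<close>
    have "{i \<in> I. g \<in> U i} \<noteq> {}" using g O a_alt[of g] by force
    then have "src G g \<in> K" by (auto simp: K_def)
    then obtain y where y: "y \<in> Y" "src G g \<in> V y" using Y(4) by blast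
    \<comment> \<open>Over \<open>V y\<close> every \<open>\<phi> i\<close> is constant, so on this
      smaller open set \<open>a\<close> depends only on which bisections contain the arrow.\<close>
    let ?O' = "?O \<inter> {g \<in> arrows G. src G g \<in> V y}"
    have op: "openin (arr_top G) ?O'"
      using continuous_src V(1)[OF y(1)]
      by (intro openin_Int openin_interior_of openin_continuous_map_preimage)
    have ne: "?O' \<noteq> {}" using g y(2) O by blast
    obtain Q S where Q: "openin (arr_top G) Q" "Q \<noteq> {}" "Q \<subseteq> ?O'" "S \<subseteq> I"
      "\<And>g. g \<in> Q \<Longrightarrow> {i \<in> I. g \<in> U i} = S"
      by (rule open_constant_membership[where U = U, OF I Uo(1) op ne], assumption) (rule that)
    have "f k \<noteq> 0" if k: "k \<in> Q" for k
    proof -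
      have kV: "src G k \<in> V y" and ak: "a k \<noteq> 0" using k Q(3) O by auto
      have "a k = (\<Sum>i\<in>S. F i y)"
        using a_alt[of k] Q(5)[OF k] \<phi>[OF y(1) kV] by simp
      \<comment> \<open>The constant value of \<open>a\<close> on \<open>Q\<close> is a non-zero
        partial sum at \<open>y\<close>, and by the choice of \<open>W y\<close> the same partial
        sum stays non-zero at the source of \<open>k\<close>.\<close>
      then have "S \<in> {S \<in> Pow I. (\<Sum>i\<in>S. F i y) \<noteq> 0}"
        using ak Q(4) by simp
      moreover have "src G k \<in> W y" using kV V(3)[OF y(1)] by (rule subsetD[rotated])
      ultimately have "(\<Sum>i\<in>S. F i (src G k)) \<in> - {0}"
        unfolding W_def by simp
      then show ?thesis using Q(5)[OF k] by (simp add: f_alt)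
    qed
    then have "Q \<subseteq> {g \<in> arrows G. f g \<noteq> 0}" using Q(3) by blast
    then have "Q \<subseteq> arr_top G interior_of {g \<in> arrows G. f g \<noteq> 0}"
      using Q(1) interior_of_maximal by blast
    then show False using f(2) Q(2) by blast
  qed

  \<comment> \<open>The error is split by bisection: each \<open>d i\<close> is continuous on
    \<open>U i\<close> but possibly not on all arrows, which is all the norm bound requires.\<close>
  define d where "d = (\<lambda>i g. if g \<in> U i then F i (src G g) - \<phi> i (src G g) else 0)"
  have dc: "continuous_map (subtopology (arr_top G) (U i)) euclidean (d i)" if "i \<in> I" for i
  proof -
    have "continuous_map (unit_top G) euclidean (\<lambda>x. F i x - \<phi> i x)"
      by (intro continuous_map_diff F(1) that \<phi>c)
    with continuous_map_from_subtopology[OF continuous_src]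
    have "continuous_map (subtopology (arr_top G) (U i)) euclidean ((\<lambda>x. F i x - \<phi> i x) \<circ> src G)"
      by (rule continuous_map_compose)
    then show ?thesis by (rule continuous_map_eq) (auto simp: d_def)
  qed
  have db: "cmod (d i g) \<le> \<epsilon>" if i: "i \<in> I" and g: "g \<in> U i" for i g
  proof -
    have "src G g \<in> K" using i g by (auto simp: K_def)
    then obtain y where y: "y \<in> Y" "src G g \<in> V y" using Y(4) by blast
    then have "src G g \<in> W y" using V(3) by blast
    then have "F i (src G g) \<in> ball (F i y) \<epsilon>" using i by (auto simp: W_def)
    then show ?thesis
      using g \<phi>[OF y] by (simp add: d_def dist_norm norm_minus_commute)
  qed
  have dz: "d i g = 0" if "g \<notin> U i" for i g using that by (simp add: d_def)
  have "f g - a g = (\<Sum>i\<in>I. d i g)" for g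
    unfolding f_alt a_alt d_def using I
    by (auto simp: sum.inter_filter simp flip: sum_subtractf intro!: sum.cong)
  then have "N (\<lambda>g. f g - a g) = N (\<lambda>g. \<Sum>i\<in>I. d i g)" by simp
  also have "\<dots> \<le> (\<Sum>i\<in>I. N (d i))"
    using connes_algebraI[OF U dc dz] by (intro Cstar_norm_sum[OF N I]) auto
  also have "\<dots> \<le> (\<Sum>i\<in>I. 2 * \<epsilon>)"
    by (intro sum_mono Cstar_norm_bisection_le[OF N U dc db dz \<epsilon>])
  also have "\<dots> < \<delta>"
    using \<delta> by (simp add: \<epsilon>_def field_simps)
  finally show ?thesis using st sing by blast
qed

end

theorem theorem7:
  fixes G :: "'g groupoid"
    and N :: "('g \<Rightarrow> complex) \<Rightarrow> real"
  assumes "ample_groupoid G"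
    and "Cstar_norm_on_connes G N"
  shows "dense_in_wrt N (algebraic_singular_ideal G) (singular_connes G)"
proof -
  interpret ample_groupoid G by fact
  show ?thesis
    unfolding dense_in_wrt_def
  proof (intro conjI ballI allI impI)
    show "algebraic_singular_ideal G \<subseteq> singular_connes G"
      using steinberg_subset_connes by (auto simp: algebraic_singular_ideal_def singular_connes_def)
    fix f \<delta> assume f: "f \<in> singular_connes G" and \<delta>: "(0 :: real) < \<delta>"
    then have f': "f \<in> connes_algebra G" "regular_rep G f \<in> singular_ideal G"
      by (auto simp: singular_connes_def)
    \<comment> \<open>For \<open>f\<close> membership in the reduced algebra is part of the
      assumption; for the approximant \<open>a\<close> it is supplied by
      \<open>regular_rep_steinberg\<close>.\<close>
    then have "arr_top G interior_of {g \<in> arrows G. f g \<noteq> 0} = {}"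
      using singular_ideal_iff by (auto simp: singular_ideal_def)
    with singular_steinberg_approximation[OF assms(2) f'(1) _ \<delta>]
    obtain a where "a \<in> steinberg_algebra G"
      "arr_top G interior_of {g \<in> arrows G. a g \<noteq> 0} = {}" "N (\<lambda>g. f g - a g) < \<delta>"
      by blast
    then show "\<exists>a\<in>algebraic_singular_ideal G. N (\<lambda>g. f g - a g) < \<delta>"
      using singular_ideal_iff[OF regular_rep_steinberg]
      by (auto simp: algebraic_singular_ideal_def)
  qed
qed

end
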